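(* Let $Ax=b$ be a consistent linear system with symmetric positive semidefinite $A\in\mathbb{R}^{n\times n}$ and solution $x^*$. Let the eigenvalues of $A$ be $\lambda_1(A)\ge\dots\ge\lambda_n(A)\ge0$, with smallest non-zero eigenvalue $\lambda_{\min}^+(A)$. Let $A\langle\mathcal S\rangle$ be a rank-$d$ Nyström approximation computed using the RPCholesky algorithm, and let $\{x^k\}_{k\ge0}$ denote the corresponding sequence of SC-RCD iterates with block size $\ell\ge1$. Fix an integer $r\ge0$ and reals $\delta>0$, $\rho\in(0,1)$. If the approximation rank $d$ satisfies $$ d\ \ge\ \frac{r}{\delta}+r\log\left(\frac{1}{\delta\,\eta_r}\right),\qquad\text{where}\quad \eta_r:=\frac{\sum_{i>r}\lambda_i(A)}{\sum_{i=1}^n\lambda_i(A)},$$ then, with probability at least $1-\rho$, the residual matrix $A^\circ=A-A\langle\mathcal S\rangle$ satisfies $$\operatorname{tr}(A^\circ)\le\rho^{-1}(1+\delta)\sum_{i>r}\lambda_i(A).$$ Furthermore, conditional on the event that this last inequality holds, denoted by $\mathcal E$, the expected relative error in the $A$-norm satisfies $$\mathbb{E}\left[\|x^k-x^*\|_A^2\mid\mathcal E\right]\le\left(1-\frac{\lambda_{\min}^+(A)}{\rho^{-1}(1+\delta)\sum_{i>r}\lambda_i(A)}\right)^{k\ell}\cdot\|x^0-x^*\|_A^2 .$$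
   Context: Notation: $\|z\|_A=\sqrt{z^{\mathsf T}Az}$; $M^\dagger$ is the Moore–Penrose pseudoinverse; $[n]=\{1,\dots,n\}$; $M_{\mathcal I,\mathcal J}$ is the submatrix with rows $\mathcal I$ and columns $\mathcal J$, where ":" means all indices; $v_{\mathcal J}$ is the subvector indexed by $\mathcal J$. Nyström approximation: for $\mathcal S\subseteq[n]$, $A\langle\mathcal S\rangle:=A_{:,\mathcal S}(A_{\mathcal S,\mathcal S})^\dagger A_{\mathcal S,:}$, and $A^\circ:=A-A\langle\mathcal S\rangle$ is the residual matrix. RPCholesky (randomly pivoted Cholesky) with rank parameter $d$ selects a random set $\mathcal S$ of pivots by adaptive diagonal sampling: set $A^{(0)}=A$, $\mathcal S=\emptyset$; for $i=1,\dots,d$ (stopping early if $A^{(i-1)}=0$), sample $s_i\in[n]$ with probability $A^{(i-1)}_{s_i,s_i}/\operatorname{tr}(A^{(i-1)})$, add $s_i$ to $\mathcal S$, and set $A^{(i)}=A^{(i-1)}-A^{(i-1)}_{:,s_i}A^{(i-1)}_{s_i,:}/A^{(i-1)}_{s_i,s_i}$. The output is $\mathcal S$ and $A\langle\mathcal S\rangle$ (in factorized form). SC-RCD (subspace-constrained randomized coordinate descent) with block size $\ell$, given $\mathcal S$: the initial iterate $x^0$ is obtained by solving $A_{\mathcal S,:}x^0=b_{\mathcal S}$. Let $C:=(A_{\mathcal S,\mathcal S})^\dagger A_{\mathcal S,:}$. In each iteration, given $x^k$ and the residual vector $r^k=Ax^k-b$, form a random subset $\mathcal J=\{j_1,\dots,j_\ell\}\subseteq[n]\setminus\mathcal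 S$ of $\ell$ coordinates, each sampled independently with probability proportional to the corresponding diagonal entry of $A^\circ$. Compute $\alpha^k=(A^\circ_{\mathcal J,\mathcal J})^\dagger r^k_{\mathcal J}$ and $\beta^k=C_{:,\mathcal J}\alpha^k$, and set $x^{k+1}_{\mathcal J}=x^k_{\mathcal J}-\alpha^k$, $x^{k+1}_{\mathcal S}=x^k_{\mathcal S}+\beta^k$, leaving the other coordinates unchanged. *)

theory Defs
  imports "HOL-Probability.Probability" "HOL-Computational_Algebra.Polynomial"
begin

text \<open>The index set [n] is the finite type \<open>'n\<close>, so n is \<open>CARD('n)\<close>; coordinate
  subsets are values of type \<open>'n set\<close>.\<close>

section \<open>Linear algebra\<close>

definition energy_norm :: "real^'n^'n \<Rightarrow> real^'n \<Rightarrow> real" where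
  "energy_norm A z = sqrt (z \<bullet> (A *v z))"

definition charpoly :: "real^'n^'n \<Rightarrow> real poly" where
  "charpoly A = det (\<chi> i j. if i = j then [:- (A $ i $ j), 1:] else [:- (A $ i $ j):])"

text \<open>The real eigenvalues in decreasing order, repeated according to algebraic multiplicity;
  for a symmetric matrix the list has length \<open>CARD('n)\<close>.\<close>

definition eigvals_desc :: "real^'n^'n \<Rightarrow> real list" where
  "eigvals_desc A = rev (sorted_list_of_multiset (proots (charpoly A)))"

text \<open>One-based: \<open>eigval A 1\<close> is the largest eigenvalue.\<close>

definition eigval :: "real^'n^'n \<Rightarrow> nat \<Rightarrow> real" where
  "eigval A i = eigvals_desc A ! (i - 1)"

definition tail_sum :: "real^'n^'n \<Rightarrow> nat \<Rightarrow> real" where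
  "tail_sum A r = (\<Sum>i\<in>{r<..CARD('n)}. eigval A i)"

definition eta :: "real^'n^'n \<Rightarrow> nat \<Rightarrow> real" where
  "eta A r = tail_sum A r / (\<Sum>i\<in>{1..CARD('n)}. eigval A i)"

definition min_nonzero_eigval :: "real^'n^'n \<Rightarrow> real" where
  "min_nonzero_eigval A = Min {x \<in> set (eigvals_desc A). x \<noteq> 0}"

text \<open>The Moore-Penrose pseudoinverse, by the four Penrose conditions.\<close>

definition pinv :: "real^'n^'m \<Rightarrow> real^'m^'n" where
  "pinv M = (THE X. M ** X ** M = M \<and> X ** M ** X = X \<and>
                    transpose (M ** X) = M ** X \<and> transpose (X ** M) = X ** M)"

text \<open>Submatrices and subvectors keep their positions in the ambient index type, and the entries
  outside the selected rows and columns are zero. Products of such matrices are the zero-padded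
  products, and since the pseudoinverse of a zero-padded matrix is the zero-padded pseudoinverse,
  all formulas below compute the zero-padded versions of the usual ones.\<close>

definition submat :: "real^'n^'m \<Rightarrow> 'm set \<Rightarrow> 'n set \<Rightarrow> real^'n^'m" where
  "submat M I J = (\<chi> i j. if i \<in> I \<and> j \<in> J then M $ i $ j else 0)"

definition subvec :: "real^'n \<Rightarrow> 'n set \<Rightarrow> real^'n" where
  "subvec v J = (\<chi> i. if i \<in> J then v $ i else 0)"

definition nystrom :: "real^'n^'n \<Rightarrow> 'n set \<Rightarrow> real^'n^'n" where
  "nystrom A S = submat A UNIV S ** pinv (submat A S S) ** submat A S UNIV"

definition residual_mat :: "real^'n^'n \<Rightarrow> 'n set \<Rightarrow> real^'n^'n" where
  "residual_mat A S = A - nystrom A S"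

section \<open>Randomly pivoted Cholesky\<close>

text \<open>Sampling from D with probability proportional to the diagonal of M. This is meaningful only
  when these diagonal entries are nonnegative and not all zero.\<close>

definition diag_pmf :: "real^'n^'n \<Rightarrow> 'n set \<Rightarrow> 'n pmf" where
  "diag_pmf M D = embed_pmf (\<lambda>j. if j \<in> D then M $ j $ j / (\<Sum>i\<in>D. M $ i $ i) else 0)"

definition cholesky_update :: "real^'n^'n \<Rightarrow> 'n \<Rightarrow> real^'n^'n" where
  "cholesky_update M s = (\<chi> i j. M $ i $ j - M $ i $ s * M $ s $ j / M $ s $ s)"

text \<open>Joint law of the current matrix and the pivots selected so far.\<close>

primrec rpcholesky_state :: "real^'n^'n \<Rightarrow> nat \<Rightarrow> ((real^'n^'n) \<times> 'n set) pmf" where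
  "rpcholesky_state A 0 = return_pmf (A, {})"
| "rpcholesky_state A (Suc i) = bind_pmf (rpcholesky_state A i) (\<lambda>(M, S).
     if M = 0 then return_pmf (M, S)
     else map_pmf (\<lambda>s. (cholesky_update M s, insert s S)) (diag_pmf M UNIV))"

definition rpcholesky :: "real^'n^'n \<Rightarrow> nat \<Rightarrow> 'n set pmf" where
  "rpcholesky A d = map_pmf snd (rpcholesky_state A d)"

section \<open>Subspace-constrained randomized coordinate descent\<close>

definition scrcd_update ::
    "real^'n^'n \<Rightarrow> real^'n \<Rightarrow> 'n set \<Rightarrow> 'n set \<Rightarrow> real^'n \<Rightarrow> real^'n" where
  "scrcd_update A b S J x =
    (let R = residual_mat A S;
         C = pinv (submat A S S) ** submat A S UNIV;
         res = A *v x - b;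
         \<alpha> = pinv (submat R J J) *v subvec res J;
         \<beta> = submat C UNIV J *v \<alpha>
     in (\<chi> i. if i \<in> J then x $ i - \<alpha> $ i else if i \<in> S then x $ i + \<beta> $ i else x $ i))"

text \<open>The block consists of the distinct values among l independent draws. If the residual matrix
  vanishes there is nothing to sample from; the method has then converged and the iterate is
  left unchanged.\<close>

definition scrcd_step ::
    "real^'n^'n \<Rightarrow> real^'n \<Rightarrow> 'n set \<Rightarrow> nat \<Rightarrow> real^'n \<Rightarrow> (real^'n) pmf" where
  "scrcd_step A b S l x =
    (if residual_mat A S = 0 then return_pmf x
     else map_pmf (\<lambda>js. scrcd_update A b S (set js) x)
            (replicate_pmf l (diag_pmf (residual_mat A S) (- S))))"

text \<open>Law of the k-th iterate for a given pivot set S and initial iterate y.\<close>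

primrec scrcd ::
    "real^'n^'n \<Rightarrow> real^'n \<Rightarrow> 'n set \<Rightarrow> nat \<Rightarrow> real^'n \<Rightarrow> nat \<Rightarrow> (real^'n) pmf" where
  "scrcd A b S l y 0 = return_pmf y"
| "scrcd A b S l y (Suc k) = bind_pmf (scrcd A b S l y k) (scrcd_step A b S l)"

text \<open>Joint law of the pivot set and the k-th iterate when S is selected by randomly pivoted
  Cholesky with rank parameter d. The initial iterate \<open>x0 S\<close> may depend on the pivot set.\<close>

definition rpc_scrcd ::
    "real^'n^'n \<Rightarrow> real^'n \<Rightarrow> nat \<Rightarrow> nat \<Rightarrow> ('n set \<Rightarrow> real^'n) \<Rightarrow> nat
      \<Rightarrow> ('n set \<times> (real^'n)) pmf" where
  "rpc_scrcd A b d l x0 k =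
    bind_pmf (rpcholesky A d) (\<lambda>S. map_pmf (Pair S) (scrcd A b S l (x0 S) k))"

end

theory Submission
  imports Defs
begin

text \<open>
  The proof has two independent halves, joined by Markov's inequality: a bound on the expected
  trace of the residual after randomly pivoted Cholesky, and a contraction estimate for coordinate
  descent that sees the pivot set only through that trace.

  \<^emph>\<open>Trace.\<close> Fix an orthonormal eigenbasis \<open>q\<close> of \<open>A\<close> and let \<open>I\<close> index the \<open>r\<close> leading
  eigenvectors. For a current residual \<open>M\<close> put \<open>a = (\<Sum>i\<in>I. q i \<bullet> M (q i))\<close> and let \<open>b\<close> be the same
  sum over the other indices, so that \<open>a + b = trace M\<close>. Since \<open>M\<close> only decreases in the Loewner
  order, \<open>b\<close> never exceeds its initial value, the spectral tail \<open>\<beta>\<close>. Averaging over the pivot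
  subtracts \<open>M\<^sup>2 / trace M\<close> from \<open>M\<close>, and two applications of the Cauchy-Schwarz inequality turn
  this into a decrease of \<open>a\<close> by at least \<open>a\<^sup>2 / (r (a + \<beta>))\<close>. The function
  \<open>a\<^sup>2 / (a + \<beta>)\<close> is convex, so the same recursion holds for the mean \<open>\<alpha>\<close> of \<open>a\<close>
  (\<open>rpcholesky_expected_head\<close>). Along this recursion \<open>ln \<alpha> - \<beta> / \<alpha>\<close> drops by at least \<open>1 / r\<close>
  in every step, and the condition on \<open>d\<close> is exactly what forces \<open>\<alpha> \<le> \<delta> \<beta>\<close> after \<open>d\<close> steps
  (\<open>potential_recursion\<close>). Hence the mean trace is at most \<open>(1 + \<delta>) \<beta>\<close>.

  \<^emph>\<open>Contraction.\<close> Solving the equations indexed by the pivots at the start, and preserving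
  them afterwards, makes the error \<open>e\<close> satisfy \<open>A e = R e\<close> for the residual matrix \<open>R\<close>, so that the
  method is block coordinate descent for the quadratic form of \<open>R\<close> (\<open>scrcd_update_error\<close>). A block
  step minimises this form over all corrections supported on the block, hence is at least as good
  as \<open>l\<close> successive one-coordinate steps along the sampled coordinates
  (\<open>block_step_optimal\<close>). One such step with diagonal sampling lowers the mean energy by
  \<open>R e \<bullet> R e / trace R\<close>, and \<open>R e \<bullet> R e\<close> is at least the smallest nonzero eigenvalue of \<open>A\<close>
  times the energy, because \<open>R e = A (e - y)\<close> for a vector \<open>e - y\<close> with the same energy
  (\<open>schur_residual_gradient_bound\<close>).

  The conditional statement follows by averaging the estimate for a fixed pivot set.
\<close>

section \<open>Positive semidefinite matrices\<close>

definition psd_matrix :: "real^'n^'n \<Rightarrow> bool" where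
  "psd_matrix M \<longleftrightarrow> transpose M = M \<and> (\<forall>z. 0 \<le> z \<bullet> (M *v z))"

lemma symmetric_matrix_inner:
  fixes M :: "real^'n^'n"
  assumes "transpose M = M"
  shows "x \<bullet> (M *v y) = (M *v x) \<bullet> y"
  by (metis assms dot_lmul_matrix vector_transpose_matrix)

lemma quadratic_form_add_scaleR:
  fixes M :: "real^'n^'n"
  assumes "transpose M = M"
  shows "(x + t *\<^sub>R y) \<bullet> (M *v (x + t *\<^sub>R y))
       = x \<bullet> (M *v x) + 2 * t * ((M *v x) \<bullet> y) + t\<^sup>2 * (y \<bullet> (M *v y))"
proof -
  have "y \<bullet> (M *v x) = (M *v x) \<bullet> y" "x \<bullet> (M *v y) = (M *v x) \<bullet> y"
    using symmetric_matrix_inner[OF assms] by (auto simp: inner_commute)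
  then show ?thesis
    by (simp add: matrix_vector_right_distrib matrix_vector_mult_scaleR inner_add_left
        inner_add_right algebra_simps power2_eq_square)
qed

text \<open>
  A vector at which a nonnegative quadratic form vanishes is a minimiser, so the gradient vanishes
  there. Nonnegativity is required only on a subspace, because the existence of eigenvectors uses
  the lemma for the shifted matrix \<open>c - A\<close>, which is nonnegative just on the invariant subspace in
  question.
\<close>

lemma quadratic_form_vanish_on_subspace:
  fixes M :: "real^'n^'n"
  assumes sym: "transpose M = M" and V: "subspace V"
    and nonneg: "\<And>u. u \<in> V \<Longrightarrow> 0 \<le> u \<bullet> (M *v u)"
    and v: "v \<in> V" "M *v v \<in> V" "v \<bullet> (M *v v) = 0"
  shows "M *v v = 0"
proof (rule ccontr)
  assume ne: "M *v v \<noteq> 0"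
  define w where "w = M *v v"
  define p where "p = w \<bullet> w"
  define c where "c = w \<bullet> (M *v w)"
  have p: "p > 0" using ne by (simp add: p_def w_def)
  have c: "c \<ge> 0" using nonneg v by (simp add: c_def w_def)
  \<comment> \<open>The minimising step would be \<open>- p / c\<close>; the added 1 covers the case \<open>c = 0\<close>.\<close>
  define t where "t = - p / (c + 1)"
  have "v + t *\<^sub>R w \<in> V"
    using V v by (simp add: w_def subspace_add subspace_scale)
  then have "0 \<le> 2 * t * p + t\<^sup>2 * c"
    using nonneg[of "v + t *\<^sub>R w"] quadratic_form_add_scaleR[OF sym, of v t w] v
    by (simp add: p_def c_def w_def)
  also have "2 * t * p + t\<^sup>2 * c = - p\<^sup>2 * (c + 2) / (c + 1)\<^sup>2"
    using c by (simp add: t_def field_simps power2_eq_square add_nonneg_eq_0_iff)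
  also have "\<dots> < 0"
    using p c by (simp add: divide_neg_pos zero_less_power)
  finally show False by simp
qed

lemma psd_matrix_null:
  assumes "psd_matrix M" "v \<bullet> (M *v v) = 0"
  shows "M *v v = 0"
  using quadratic_form_vanish_on_subspace[of M UNIV v] assms by (auto simp: psd_matrix_def)

section \<open>Spectral theorem\<close>

text \<open>
  A maximiser of the Rayleigh quotient on the unit sphere of the subspace is an eigenvector: the
  form of \<open>c - A\<close>, with \<open>c\<close> the maximum, is nonnegative on the subspace and vanishes at the
  maximiser.
\<close>

lemma symmetric_eigenvector_in_invariant_subspace:
  fixes A :: "real^'n^'n"
  assumes sym: "transpose A = A" and V: "subspace V" and inv: "\<And>x. x \<in> V \<Longrightarrow> A *v x \<in> V"
    and ne: "\<exists>x\<in>V. x \<noteq> 0"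
  obtains v c where "v \<in> V" "norm v = 1" "A *v v = c *\<^sub>R v"
proof -
  define K where "K = sphere 0 1 \<inter> V"
  have "compact K"
    unfolding K_def using V closed_subspace by (intro compact_Int_closed) auto
  moreover have "K \<noteq> {}"
  proof -
    obtain x where "x \<in> V" "x \<noteq> 0" using ne by blast
    then have "(1 / norm x) *\<^sub>R x \<in> K" using V by (simp add: K_def subspace_scale)
    then show ?thesis by blast
  qed
  moreover have "continuous_on K (\<lambda>x. x \<bullet> (A *v x))"
    by (intro continuous_intros linear_continuous_on matrix_vector_mul_bounded_linear)
  ultimately obtain v where v: "v \<in> K" and vmax: "\<And>u. u \<in> K \<Longrightarrow> u \<bullet> (A *v u) \<le> v \<bullet> (A *v v)"
    using continuous_attains_sup by metis
  define c where "c = v \<bullet> (A *v v)"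
  define B where "B = c *\<^sub>R mat 1 - A"
  have Bv: "B *v x = c *\<^sub>R x - A *v x" for x
    by (simp add: B_def matrix_vector_mult_diff_rdistrib scaleR_matrix_vector_assoc[symmetric])
  have vV: "v \<in> V" and nv: "norm v = 1" using v by (auto simp: K_def)
  have "transpose B = B"
    using sym by (simp add: B_def vec_eq_iff transpose_def mat_def)
  moreover have "0 \<le> u \<bullet> (B *v u)" if "u \<in> V" for u
  proof (cases "u = 0")
    case False
    have "(1 / norm u) *\<^sub>R u \<in> K" using V that False by (simp add: K_def subspace_scale)
    from vmax[OF this] have "(u \<bullet> (A *v u)) / (norm u)\<^sup>2 \<le> c"
      by (simp add: c_def matrix_vector_mult_scaleR power2_eq_square)
    then have "u \<bullet> (A *v u) \<le> c * (norm u)\<^sup>2"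
      using False by (simp add: field_simps)
    then show ?thesis
      by (simp add: Bv inner_diff_right power2_norm_eq_inner)
  qed simp
  moreover have "B *v v \<in> V" using V vV inv by (simp add: Bv subspace_diff subspace_scale)
  moreover have "v \<bullet> (B *v v) = 0"
    using nv by (simp add: Bv inner_diff_right c_def norm_eq_1)
  ultimately have "B *v v = 0"
    using quadratic_form_vanish_on_subspace[of B V v] V vV by blast
  then have "A *v v = c *\<^sub>R v" by (simp add: Bv)
  then show thesis using that vV nv by blast
qed

text \<open>
  The vectors are indexed by the coordinate type itself, so an orthonormal family of this shape has
  the right cardinality to be a basis, and the spectrum carries its multiplicities as the fibres of
  \<open>c\<close>.
\<close>

definition eigenbasis :: "real^'n^'n \<Rightarrow> ('n \<Rightarrow> real^'n) \<Rightarrow> ('n \<Rightarrow> real) \<Rightarrow> bool" where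
  "eigenbasis A q c \<longleftrightarrow>
     (\<forall>i j. q i \<bullet> q j = (if i = j then 1 else 0)) \<and> (\<forall>i. A *v q i = c i *\<^sub>R q i)"

theorem symmetric_eigenbasis_exists:
  fixes A :: "real^'n^'n"
  assumes sym: "transpose A = A"
  obtains q c where "eigenbasis A q c"
proof -
  define orthonormal_eigenvectors where "orthonormal_eigenvectors B \<longleftrightarrow> finite B
      \<and> (\<forall>u\<in>B. norm u = 1 \<and> (\<exists>c. A *v u = c *\<^sub>R u))
      \<and> (\<forall>u\<in>B. \<forall>w\<in>B. u \<noteq> w \<longrightarrow> u \<bullet> w = 0)" for B :: "(real^'n) set"
  \<comment> \<open>The orthogonal complement of a set of eigenvectors is invariant under a symmetric matrix, so
    the set can be enlarged until its size is the dimension.\<close>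
  have ex: "k \<le> CARD('n) \<Longrightarrow> \<exists>B. orthonormal_eigenvectors B \<and> card B = k" for k
  proof (induction k)
    case 0
    show ?case by (rule exI[of _ "{}"]) (simp add: orthonormal_eigenvectors_def)
  next
    case (Suc k)
    then obtain B where B: "orthonormal_eigenvectors B" "card B = k" by auto
    define V where "V = {x. \<forall>u\<in>B. u \<bullet> x = 0}"
    have V: "subspace V"
      by (auto simp: V_def subspace_def inner_add_right)
    have inv: "A *v x \<in> V" if "x \<in> V" for x
    proof -
      have "u \<bullet> (A *v x) = 0" if u: "u \<in> B" for u
      proof -
        have "\<exists>c. A *v u = c *\<^sub>R u" using B(1) u unfolding orthonormal_eigenvectors_def by blast
        then obtain c where "A *v u = c *\<^sub>R u" ..
        then show ?thesis
          using symmetric_matrix_inner[OF sym, of u x] \<open>x \<in> V\<close> u by (simp add: V_def)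
      qed
      then show ?thesis by (simp add: V_def)
    qed
    have "dim (span B) < DIM(real^'n)"
      using dim_le_card'[of B] B Suc.prems by (simp add: orthonormal_eigenvectors_def)
    then obtain x where x: "x \<noteq> 0" "\<And>y. y \<in> span (span B) \<Longrightarrow> orthogonal x y"
      using orthogonal_to_subspace_exists[of "span B"] by metis
    then have "x \<in> V"
      by (auto simp: V_def orthogonal_def inner_commute span_base span_superset)
    then obtain v c where v: "v \<in> V" "norm v = 1" "A *v v = c *\<^sub>R v"
      using symmetric_eigenvector_in_invariant_subspace[OF sym V inv] x(1) by metis
    have "v \<notin> B"
    proof
      assume "v \<in> B"
      then have "v \<bullet> v = 0" using v(1) by (simp add: V_def)
      then show False using v(2) by auto
    qed
    then have "orthonormal_eigenvectors (insert v B)" "card (insert v B) = Suc k"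
      using B v by (auto simp: orthonormal_eigenvectors_def V_def inner_commute)
    then show ?case by blast
  qed
  obtain B where B: "orthonormal_eigenvectors B" "card B = CARD('n)" using ex[of "CARD('n)"] by auto
  then obtain q where q: "bij_betw q (UNIV :: 'n set) B"
    using finite_same_card_bij[of "UNIV :: 'n set" B] by (auto simp: orthonormal_eigenvectors_def)
  have qB: "q i \<in> B" for i using q by (auto simp: bij_betw_def)
  have inj: "q i = q j \<longleftrightarrow> i = j" for i j using q by (auto simp: bij_betw_def inj_on_def)
  have "\<exists>c. A *v q i = c *\<^sub>R q i" for i using B qB[of i] by (auto simp: orthonormal_eigenvectors_def)
  then obtain c where "\<And>i. A *v q i = c i *\<^sub>R q i" by metis
  moreover have "q i \<bullet> q j = (if i = j then 1 else 0)" for i j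
    using B qB[of i] qB[of j] inj[of i j] by (auto simp: orthonormal_eigenvectors_def norm_eq_1)
  ultimately have "eigenbasis A q c" unfolding eigenbasis_def by blast
  then show thesis by (rule that)
qed

text \<open>
  A square matrix with orthonormal columns also has orthonormal rows.
\<close>

lemma eigenbasis_resolution_identity:
  fixes A :: "real^'n^'n"
  assumes "eigenbasis A q c"
  shows "(\<Sum>i\<in>UNIV. q i $ a * q i $ b) = (if a = b then 1 else 0)"
proof -
  define Q :: "real^'n^'n" where "Q = (\<chi> a i. q i $ a)"
  have "transpose Q ** Q = mat 1"
    using assms by (simp add: vec_eq_iff Q_def transpose_def matrix_matrix_mult_def mat_def
        eigenbasis_def inner_vec_def)
  then have "Q ** transpose Q = mat 1" by (simp add: matrix_left_right_inverse)
  then have "(Q ** transpose Q) $ a $ b = mat 1 $ a $ b" by simp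
  then show ?thesis by (simp add: Q_def transpose_def matrix_matrix_mult_def mat_def)
qed

lemma eigenbasis_expansion:
  fixes A :: "real^'n^'n"
  assumes "eigenbasis A q c"
  shows "x = (\<Sum>i\<in>UNIV. (q i \<bullet> x) *\<^sub>R q i)"
proof -
  have "(\<Sum>i\<in>UNIV. (q i \<bullet> x) *\<^sub>R q i) $ a = x $ a" for a
  proof -
    have "(\<Sum>i\<in>UNIV. (q i \<bullet> x) *\<^sub>R q i) $ a = (\<Sum>i\<in>UNIV. \<Sum>b\<in>UNIV. x $ b * (q i $ a * q i $ b))"
      by (simp add: inner_vec_def sum_distrib_left sum_distrib_right algebra_simps)
    also have "\<dots> = (\<Sum>b\<in>UNIV. x $ b * (\<Sum>i\<in>UNIV. q i $ a * q i $ b))"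
      by (subst sum.swap) (simp add: sum_distrib_left)
    also have "\<dots> = x $ a"
      by (simp add: eigenbasis_resolution_identity[OF assms] if_distrib cong: if_cong)
    finally show ?thesis .
  qed
  then show ?thesis by (simp add: vec_eq_iff)
qed

lemma eigenbasis_trace:
  fixes A M :: "real^'n^'n"
  assumes "eigenbasis A q c"
  shows "trace M = (\<Sum>i\<in>UNIV. q i \<bullet> (M *v q i))"
proof -
  have "(\<Sum>i\<in>UNIV. q i \<bullet> (M *v q i)) = (\<Sum>i\<in>UNIV. \<Sum>a\<in>UNIV. \<Sum>b\<in>UNIV. M $ a $ b * (q i $ a * q i $ b))"
    by (simp add: inner_vec_def matrix_vector_mult_def sum_distrib_left algebra_simps)
  also have "\<dots> = (\<Sum>a\<in>UNIV. \<Sum>i\<in>UNIV. \<Sum>b\<in>UNIV. M $ a $ b * (q i $ a * q i $ b))"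
    by (rule sum.swap)
  also have "\<dots> = (\<Sum>a\<in>UNIV. \<Sum>b\<in>UNIV. M $ a $ b * (\<Sum>i\<in>UNIV. q i $ a * q i $ b))"
    unfolding sum_distrib_left by (intro sum.cong refl sum.swap)
  also have "\<dots> = trace M"
    by (simp add: eigenbasis_resolution_identity[OF assms] trace_def if_distrib cong: if_cong)
  finally show ?thesis by simp
qed

lemma eigenbasis_coefficient:
  fixes A :: "real^'n^'n"
  assumes "transpose A = A" "eigenbasis A q c"
  shows "q i \<bullet> (A *v x) = c i * (q i \<bullet> x)"
  using assms symmetric_matrix_inner[of A "q i" x] by (simp add: eigenbasis_def)

lemma eigenbasis_parseval:
  fixes A :: "real^'n^'n"
  assumes "eigenbasis A q c"
  shows "x \<bullet> y = (\<Sum>i\<in>UNIV. (q i \<bullet> x) * (q i \<bullet> y))"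
proof -
  have "x \<bullet> y = (\<Sum>i\<in>UNIV. (q i \<bullet> x) *\<^sub>R q i) \<bullet> y"
    using eigenbasis_expansion[OF assms, of x] by simp
  then show ?thesis by (simp add: inner_sum_left)
qed

section \<open>The characteristic polynomial and the ordered spectrum\<close>

text \<open>
  The eigenvector matrix conjugates \<open>X - A\<close> to a diagonal matrix. The conjugation takes place over
  the polynomial ring, with the eigenvectors embedded as constant polynomials; the determinant of
  the eigenvector matrix is a unit there and cancels.
\<close>

lemma charpoly_eigenbasis:
  fixes A :: "real^'n^'n"
  assumes eb: "eigenbasis A q c"
  shows "charpoly A = (\<Prod>i\<in>UNIV. [:- c i, 1:])"
proof -
  define P :: "real poly^'n^'n" where "P = (\<chi> a i. [:q i $ a:])"
  define X :: "real poly^'n^'n"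
    where "X = (\<chi> i j. if i = j then [:- (A $ i $ j), 1:] else [:- (A $ i $ j):])"
  define D :: "real poly^'n^'n" where "D = (\<chi> i j. if i = j then [:- c i, 1:] else 0)"
  have const_sum: "(\<Sum>i\<in>S. [:f i:]) = [:sum f S:]" for f :: "'n \<Rightarrow> real" and S
    by (induction S rule: infinite_finite_induct) auto
  have orth: "transpose P ** P = mat 1"
  proof -
    have "(\<Sum>k\<in>UNIV. q i $ k * q j $ k) = (if i = j then 1 else 0)" for i j
      using eb by (simp add: eigenbasis_def inner_vec_def)
    then show ?thesis
      by (simp add: vec_eq_iff P_def transpose_def matrix_matrix_mult_def mat_def const_sum)
  qed
  have XP: "X ** P = P ** D"
  proof -
    have "(X ** P) $ a $ i = (P ** D) $ a $ i" for a i
    proof -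
      have eig: "(\<Sum>b\<in>UNIV. A $ a $ b * q i $ b) = c i * q i $ a"
      proof -
        have "(A *v q i) $ a = (c i *\<^sub>R q i) $ a" using eb by (simp add: eigenbasis_def)
        then show ?thesis by (simp add: matrix_vector_mult_def)
      qed
      have "(X ** P) $ a $ i
          = (\<Sum>b\<in>UNIV. (if a = b then [:0, q i $ b:] else 0) + [:- (A $ a $ b * q i $ b):])"
        unfolding matrix_matrix_mult_def X_def P_def by (auto intro!: sum.cong)
      also have "\<dots> = [:0, q i $ a:] + [:- (c i * q i $ a):]"
        by (simp add: sum.distrib const_sum sum_negf eig)
      also have "\<dots> = [:q i $ a:] * [:- c i, 1:]" by simp
      also have "\<dots> = (P ** D) $ a $ i"
        by (simp add: matrix_matrix_mult_def P_def D_def if_distrib cong: if_cong)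
      finally show ?thesis .
    qed
    then show ?thesis by (simp add: vec_eq_iff)
  qed
  have "det (transpose P) * det P = 1"
    using arg_cong[OF orth, of det] by (simp add: det_mul)
  then have "det P \<noteq> 0" by auto
  moreover have "det X * det P = det P * det D"
    using arg_cong[OF XP, of det] by (simp add: det_mul)
  ultimately have "det X = det D" by simp
  moreover have "det D = (\<Prod>i\<in>UNIV. [:- c i, 1:])"
    by (subst det_diagonal) (auto simp: D_def)
  ultimately show ?thesis by (simp add: charpoly_def X_def)
qed

lemma eigvals_desc_enumeration:
  fixes A :: "real^'n^'n"
  assumes eb: "eigenbasis A q c"
  obtains xs where "distinct xs" "set xs = (UNIV :: 'n set)" "eigvals_desc A = map c xs"
proof -
  have roots: "proots (charpoly A) = (\<Sum>i\<in>UNIV. {#c i#})"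
    unfolding charpoly_eigenbasis[OF eb] by (subst proots_prod) auto
  obtain ys where ys: "set ys = (UNIV :: 'n set)" "distinct ys"
    using finite_distinct_list[of "UNIV :: 'n set"] by auto
  define zs where "zs = sort_key c ys"
  have zs: "distinct zs" "set zs = UNIV" "sorted (map c zs)"
    using ys by (simp_all add: zs_def)
  have "mset (map c zs) = (\<Sum>i\<in>UNIV. {#c i#})"
  proof -
    have "mset (map c zs) = (\<Sum>i\<leftarrow>zs. {#c i#})" by (induction zs) auto
    also have "\<dots> = (\<Sum>i\<in>set zs. {#c i#})"
      using zs(1) by (rule sum_list_distinct_conv_sum_set)
    finally show ?thesis using zs(2) by simp
  qed
  then have "sorted_list_of_multiset (proots (charpoly A)) = map c zs"
    using zs(3) by (metis roots sorted_list_of_multiset_mset sort_key_id_if_sorted list.map_id sorted_sort_id)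
  then have "eigvals_desc A = map c (rev zs)" by (simp add: eigvals_desc_def rev_map)
  then show thesis using that[of "rev zs"] zs by simp
qed

text \<open>
  Here \<open>I\<close> collects the first \<open>r\<close> indices when the eigenbasis is sorted by decreasing eigenvalue.
  The trace estimate works with \<open>I\<close> and an arbitrarily ordered eigenbasis instead of the sorted list.
\<close>

lemma eigval_sums:
  fixes A :: "real^'n^'n"
  assumes eb: "eigenbasis A q c" and r: "r \<le> CARD('n)"
  obtains I where "card I = r" "tail_sum A r = (\<Sum>i\<in>- I. c i)"
    "(\<Sum>i\<in>{1..CARD('n)}. eigval A i) = (\<Sum>i\<in>UNIV. c i)"
proof -
  obtain xs where xs: "distinct xs" "set xs = (UNIV :: 'n set)" "eigvals_desc A = map c xs"
    using eigvals_desc_enumeration[OF eb] by blast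
  have len: "length xs = CARD('n)" using xs distinct_card by fastforce
  have eig: "eigval A i = c (xs ! (i - 1))" if "i \<in> {1..CARD('n)}" for i
    unfolding eigval_def xs(3) using that len by (intro nth_map) auto
  have seg: "(\<Sum>i\<in>{m<..CARD('n)}. eigval A i) = (\<Sum>i\<in>set (drop m xs). c i)" if "m \<le> CARD('n)" for m
  proof -
    have "(\<Sum>i\<in>{m<..CARD('n)}. eigval A i) = (\<Sum>i\<in>{m<..CARD('n)}. c (xs ! (i - 1)))"
      using eig by (intro sum.cong) auto
    also have "\<dots> = (\<Sum>i\<in>{m..<CARD('n)}. c (xs ! i))"
      by (rule sum.reindex_bij_witness[of _ Suc "\<lambda>i. i - 1"]) auto
    also have "\<dots> = (\<Sum>i<length (drop m xs). c (drop m xs ! i))"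
      by (rule sum.reindex_bij_witness[of _ "\<lambda>i. i + m" "\<lambda>i. i - m"]) (use that len in auto)
    also have "\<dots> = (\<Sum>i\<in>set (drop m xs). c i)"
      using xs(1) by (simp add: sum_list_distinct_conv_sum_set[symmetric] sum_list_sum_nth
          atLeast0LessThan)
    finally show ?thesis .
  qed
  have "set (drop r xs) = - set (take r xs)"
    using xs(1,2) set_take_disj_set_drop_if_distinct[OF xs(1), of r r]
    by (metis Compl_eq_Diff_UNIV append_take_drop_id set_append Un_Diff_cancel2 Diff_triv
        inf_commute order_refl Un_Diff Diff_cancel sup_bot_left)
  moreover have "card (set (take r xs)) = r"
    using xs(1) r len by (simp add: distinct_card)
  moreover have "{1..CARD('n)} = {0<..CARD('n)}" by auto
  ultimately show thesis
    using that[of "set (take r xs)"] seg[of r] seg[of 0] r xs(2) by (simp add: tail_sum_def)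
qed

lemma min_nonzero_eigval_le:
  fixes A :: "real^'n^'n"
  assumes eb: "eigenbasis A q c" and "c i \<noteq> 0"
  shows "min_nonzero_eigval A \<le> c i"
proof -
  obtain xs where "set xs = (UNIV :: 'n set)" "eigvals_desc A = map c xs"
    using eigvals_desc_enumeration[OF eb] by blast
  then show ?thesis
    unfolding min_nonzero_eigval_def using assms by (intro Min_le) auto
qed

lemma psd_eigenvalues_nonneg:
  fixes A :: "real^'n^'n"
  assumes "psd_matrix A" "eigenbasis A q c"
  shows "c i \<ge> 0"
proof -
  have "0 \<le> q i \<bullet> (A *v q i)" using assms(1) by (simp add: psd_matrix_def)
  then show ?thesis using assms(2) by (simp add: eigenbasis_def)
qed

lemma min_nonzero_eigval_gradient_bound:
  fixes A :: "real^'n^'n"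
  assumes psd: "psd_matrix A"
  shows "min_nonzero_eigval A * (x \<bullet> (A *v x)) \<le> (A *v x) \<bullet> (A *v x)"
proof -
  have sym: "transpose A = A" using psd by (simp add: psd_matrix_def)
  obtain q c where eb: "eigenbasis A q c" using symmetric_eigenbasis_exists[OF sym] by blast
  have "min_nonzero_eigval A * (c i * (q i \<bullet> x)\<^sup>2) \<le> c i * (c i * (q i \<bullet> x)\<^sup>2)" for i
    using min_nonzero_eigval_le[OF eb, of i] psd_eigenvalues_nonneg[OF psd eb, of i]
    by (cases "c i = 0") (auto intro!: mult_right_mono)
  then have "(\<Sum>i\<in>UNIV. min_nonzero_eigval A * (c i * (q i \<bullet> x)\<^sup>2))
      \<le> (\<Sum>i\<in>UNIV. c i * (c i * (q i \<bullet> x)\<^sup>2))" by (intro sum_mono)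
  then show ?thesis
    by (simp add: eigenbasis_parseval[OF eb, of x] eigenbasis_parseval[OF eb, of "A *v x"]
        eigenbasis_coefficient[OF sym eb] sum_distrib_left power2_eq_square algebra_simps)
qed

section \<open>Pseudoinverse\<close>

definition penrose :: "real^'n^'m \<Rightarrow> real^'m^'n \<Rightarrow> bool" where
  "penrose M X \<longleftrightarrow> M ** X ** M = M \<and> X ** M ** X = X \<and>
     transpose (M ** X) = M ** X \<and> transpose (X ** M) = X ** M"

text \<open>
  Both \<open>M X\<close> and \<open>M Y\<close> are the orthogonal projection onto the range of \<open>M\<close>, and both \<open>X M\<close> and
  \<open>Y M\<close> the one onto the orthogonal complement of its kernel.
\<close>

lemma penrose_unique:
  assumes X: "penrose M X" and Y: "penrose M Y"
  shows "X = Y"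
proof -
  have MX: "M ** X = M ** Y"
  proof -
    have "M ** X = transpose (M ** X)" using X by (simp add: penrose_def)
    also have "\<dots> = transpose (M ** Y ** (M ** X))"
      using Y by (simp add: penrose_def matrix_mul_assoc)
    also have "\<dots> = transpose (M ** X) ** transpose (M ** Y)" by (rule matrix_transpose_mul)
    also have "\<dots> = M ** X ** (M ** Y)" using X Y by (simp add: penrose_def)
    also have "\<dots> = M ** Y" using X by (simp add: penrose_def matrix_mul_assoc)
    finally show ?thesis .
  qed
  have XM: "X ** M = Y ** M"
  proof -
    have "X ** M = transpose (X ** M)" using X by (simp add: penrose_def)
    also have "\<dots> = transpose (X ** M ** (Y ** M))"
      using Y by (metis penrose_def matrix_mul_assoc)
    also have "\<dots> = transpose (Y ** M) ** transpose (X ** M)" by (rule matrix_transpose_mul)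
    also have "\<dots> = Y ** M ** (X ** M)" using X Y by (simp add: penrose_def)
    also have "\<dots> = Y ** M" using X by (metis penrose_def matrix_mul_assoc)
    finally show ?thesis .
  qed
  have "X = X ** M ** X" using X by (simp add: penrose_def)
  also have "\<dots> = Y ** (M ** X)" by (simp add: XM matrix_mul_assoc)
  also have "\<dots> = Y" using Y by (simp add: MX matrix_mul_assoc penrose_def)
  finally show ?thesis .
qed

lemma penrose_pinv:
  assumes "penrose M X"
  shows "penrose M (pinv M)"
proof -
  have eq: "pinv M = (THE X. penrose M X)" unfolding pinv_def penrose_def ..
  show ?thesis unfolding eq using assms penrose_unique by (metis theI)
qed

text \<open>
  Inverting the nonzero eigenvalues on an eigenbasis gives the pseudoinverse; the convention that
  the inverse of 0 is 0 treats the kernel correctly.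
\<close>

lemma symmetric_penrose_exists:
  fixes G :: "real^'n^'n"
  assumes sym: "transpose G = G"
  obtains X where "penrose G X"
proof -
  obtain q c where eb: "eigenbasis G q c" using symmetric_eigenbasis_exists[OF sym] by blast
  define X :: "real^'n^'n"
    where "X = (\<chi> a b. \<Sum>i\<in>UNIV. inverse (c i) * q i $ a * q i $ b)"
  have symX: "transpose X = X"
    by (simp add: X_def transpose_def vec_eq_iff algebra_simps)
  have Xv: "X *v x = (\<Sum>i\<in>UNIV. (inverse (c i) * (q i \<bullet> x)) *\<^sub>R q i)" for x
    unfolding vec_eq_iff X_def matrix_vector_mult_def inner_vec_def
    by (simp add: sum_distrib_left sum_distrib_right algebra_simps)
       (subst sum.swap, simp)
  have Xq: "X *v q i = inverse (c i) *\<^sub>R q i" for i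
  proof -
    have "X *v q i = (\<Sum>j\<in>UNIV. (if j = i then inverse (c i) *\<^sub>R q i else 0))"
      unfolding Xv using eb by (intro sum.cong) (auto simp: eigenbasis_def)
    then show ?thesis by simp
  qed
  have Gq: "G *v q i = c i *\<^sub>R q i" for i using eb by (simp add: eigenbasis_def)
  have eqI: "M = N" if "\<And>i. M *v q i = N *v q i" for M N :: "real^'n^'n"
  proof -
    have "M *v x = N *v x" for x
    proof -
      have "L *v x = (\<Sum>i\<in>UNIV. (q i \<bullet> x) *\<^sub>R (L *v q i))" for L :: "real^'n^'n"
        by (subst eigenbasis_expansion[OF eb, of x])
           (simp add: linear_sum[OF matrix_vector_mul_linear] matrix_vector_mult_scaleR)
      then show ?thesis using that by simp
    qed
    then show ?thesis by (simp add: matrix_eq)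
  qed
  have comm: "G ** X = X ** G"
    by (rule eqI) (simp add: matrix_vector_mul_assoc[symmetric] Gq Xq matrix_vector_mult_scaleR)
  have "G ** X ** G = G"
    by (rule eqI, rename_tac i, case_tac "c i = 0")
       (simp_all add: matrix_vector_mul_assoc[symmetric] Gq Xq matrix_vector_mult_scaleR)
  moreover have "X ** G ** X = X"
    by (rule eqI, rename_tac i, case_tac "c i = 0")
       (simp_all add: matrix_vector_mul_assoc[symmetric] Gq Xq matrix_vector_mult_scaleR)
  moreover have "transpose (G ** X) = G ** X" "transpose (X ** G) = X ** G"
    using comm sym symX by (simp_all add: matrix_transpose_mul)
  ultimately show thesis using that by (simp add: penrose_def)
qed

lemma pinv_symmetric:
  fixes G :: "real^'n^'n"
  assumes sym: "transpose G = G"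
  shows "G *v (pinv G *v (G *v x)) = G *v x"
    and "pinv G *v (G *v (pinv G *v x)) = pinv G *v x"
    and "transpose (pinv G) = pinv G"
    and "G *v (pinv G *v x) = pinv G *v (G *v x)"
proof -
  have P: "penrose G (pinv G)"
    using symmetric_penrose_exists[OF sym] penrose_pinv by metis
  show "G *v (pinv G *v (G *v x)) = G *v x" "pinv G *v (G *v (pinv G *v x)) = pinv G *v x"
    using P by (simp_all add: matrix_vector_mul_assoc penrose_def matrix_mul_assoc)
  have "penrose G (transpose (pinv G))"
    using P sym unfolding penrose_def
    by (metis matrix_transpose_mul transpose_transpose matrix_mul_assoc)
  then show tr: "transpose (pinv G) = pinv G" using penrose_unique[OF _ P] by blast
  have "G ** pinv G = pinv G ** G"
    using P sym tr unfolding penrose_def by (metis matrix_transpose_mul)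
  then show "G *v (pinv G *v x) = pinv G *v (G *v x)"
    by (simp add: matrix_vector_mul_assoc)
qed

section \<open>Nystrom residuals\<close>

lemma subvec_nth [simp]: "subvec v S $ i = (if i \<in> S then v $ i else 0)"
  by (simp add: subvec_def)

lemma subvec_idem [simp]: "subvec (subvec v S) S = subvec v S"
  by (simp add: vec_eq_iff)

lemma subvec_diff: "subvec (x - y) S = subvec x S - subvec y S"
  by (simp add: vec_eq_iff)

lemma subvec_inner: "subvec x S \<bullet> y = x \<bullet> subvec y S"
  by (simp add: inner_vec_def if_distrib cong: if_cong) (intro sum.cong, auto)

lemma submat_mult_vec: "submat M I J *v x = subvec (M *v subvec x J) I"
  by (auto simp: vec_eq_iff submat_def matrix_vector_mult_def intro!: sum.cong)

lemma submat_symmetric: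
  assumes "transpose M = M"
  shows "transpose (submat M J J) = submat M J J"
  using assms by (auto simp: vec_eq_iff transpose_def submat_def)

text \<open>
  The pseudoinverse of a symmetric matrix commutes with it, so it has the same range and kernel. In
  particular the pseudoinverse of a zero-padded matrix is again zero-padded.
\<close>

lemma pinv_submat_supported:
  fixes A :: "real^'n^'n"
  assumes "transpose A = A"
  shows "subvec (pinv (submat A S S) *v x) S = pinv (submat A S S) *v x"
    and "pinv (submat A S S) *v subvec x S = pinv (submat A S S) *v x"
proof -
  let ?G = "submat A S S" and ?X = "pinv (submat A S S)"
  note X = pinv_symmetric[OF submat_symmetric[OF assms, of S]]
  have "?X *v x = ?G *v (?X *v (?X *v x))" for x
    using X(2,4) by metis
  then show "subvec (?X *v x) S = ?X *v x"
    by (metis submat_mult_vec subvec_idem)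
  have "?X *v x = ?X *v (?X *v (?G *v x))" for x
    using X(2,4) by metis
  moreover have "?G *v subvec x S = ?G *v x" by (simp add: submat_mult_vec)
  ultimately show "?X *v subvec x S = ?X *v x" by metis
qed

text \<open>
  On vectors supported on \<open>S\<close>, the kernel of the block \<open>A S S\<close> is contained in the kernel of \<open>A\<close>,
  because both are the null vectors of the same quadratic form. Hence the pseudoinverse of the
  block acts as an honest inverse whenever it meets \<open>A\<close>: the Nystrom approximation reproduces the
  columns and the rows of \<open>A\<close> indexed by \<open>S\<close>.
\<close>

lemma psd_matrix_pinv_submat_absorb:
  fixes A :: "real^'n^'n"
  assumes psd: "psd_matrix A"
  shows "A *v (pinv (submat A S S) *v (A *v subvec x S)) = A *v subvec x S"
    and "subvec (A *v (pinv (submat A S S) *v (A *v x))) S = subvec (A *v x) S"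
proof -
  let ?G = "submat A S S" and ?X = "pinv (submat A S S)"
  have sym: "transpose A = A" using psd by (simp add: psd_matrix_def)
  note X = pinv_symmetric[OF submat_symmetric[OF sym, of S]]
  note supp = pinv_submat_supported[OF sym, of S]
  have *: "A *v subvec x S = A *v (?X *v (?G *v x))" for x
  proof -
    define y where "y = x - ?X *v (?G *v x)"
    have "?G *v y = 0" using X(1) by (simp add: y_def matrix_vector_mult_diff_distrib)
    then have "subvec y S \<bullet> (A *v subvec y S) = 0"
      by (simp add: subvec_inner submat_mult_vec)
    then have "A *v subvec y S = 0" by (rule psd_matrix_null[OF psd])
    then show ?thesis
      by (simp add: y_def subvec_diff supp(1) matrix_vector_mult_diff_distrib)
  qed
  have GX: "?X *v (?G *v x) = ?X *v (A *v subvec x S)" for x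
    by (simp add: submat_mult_vec supp(2))
  show "A *v (?X *v (A *v subvec x S)) = A *v subvec x S"
    using * GX by metis
  have "y \<bullet> subvec (A *v (?X *v (A *v x))) S = y \<bullet> subvec (A *v x) S" for y
  proof -
    have "y \<bullet> subvec (A *v (?X *v (A *v x))) S = (A *v subvec y S) \<bullet> (?X *v (A *v x))"
      by (simp add: subvec_inner[symmetric] symmetric_matrix_inner[OF sym])
    also have "\<dots> = (A *v (?X *v (A *v subvec y S))) \<bullet> x"
      by (simp add: symmetric_matrix_inner[OF X(3)] symmetric_matrix_inner[OF sym])
    also have "\<dots> = y \<bullet> subvec (A *v x) S"
      using * GX by (simp add: subvec_inner[symmetric] symmetric_matrix_inner[OF sym])
    finally show ?thesis .
  qed
  then show "subvec (A *v (?X *v (A *v x))) S = subvec (A *v x) S"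
    using vector_eq_ldot by blast
qed

lemma residual_mat_mult_vec:
  fixes A :: "real^'n^'n"
  assumes "transpose A = A"
  shows "residual_mat A S *v x = A *v x - A *v (pinv (submat A S S) *v (A *v x))"
  using pinv_submat_supported[OF assms, of S]
  by (simp add: residual_mat_def nystrom_def matrix_vector_mult_diff_rdistrib
      matrix_vector_mul_assoc[symmetric] submat_mult_vec) (simp add: subvec_def)

text \<open>
  A description of the residual without pseudoinverses: \<open>M\<close> arises from \<open>A\<close> by eliminating
  variables indexed by \<open>S\<close>, and nothing is left on \<open>S\<close>. This form is preserved by single Cholesky
  steps, and \<open>schur_residual_unique\<close> recovers the Nystrom residual from it. Of the bounds
  \<open>0 \<le> M \<le> A\<close>, the lower one makes the diagonal a sampling weight, and the upper one keeps
  \<open>q \<bullet> M q\<close> below its initial value for every trailing eigenvector \<open>q\<close>.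
\<close>

definition schur_residual :: "real^'n^'n \<Rightarrow> 'n set \<Rightarrow> real^'n^'n \<Rightarrow> bool" where
  "schur_residual A S M \<longleftrightarrow> psd_matrix M \<and> (\<forall>z. z \<bullet> (M *v z) \<le> z \<bullet> (A *v z)) \<and>
     (\<forall>x. subvec (M *v x) S = 0) \<and> (\<forall>x. \<exists>y. subvec y S = y \<and> M *v x = A *v (x - y))"

lemma schur_residualD:
  assumes "schur_residual A S M"
  shows "psd_matrix M" "transpose M = M" "z \<bullet> (M *v z) \<le> z \<bullet> (A *v z)"
    and "i \<in> S \<Longrightarrow> (M *v x) $ i = 0" "\<exists>y. subvec y S = y \<and> M *v x = A *v (x - y)"
proof -
  assume i: "i \<in> S"
  have "subvec (M *v x) S $ i = 0" using assms by (simp add: schur_residual_def)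
  then show "(M *v x) $ i = 0" using i by simp
qed (use assms in \<open>auto simp: schur_residual_def psd_matrix_def\<close>)

text \<open>
  Two ways of eliminating \<open>S\<close> differ by a vector \<open>w\<close> supported on \<open>S\<close> with \<open>A w\<close> vanishing on \<open>S\<close>.
  Its energy is therefore 0, and then \<open>A w = 0\<close>.
\<close>

lemma schur_residual_unique:
  fixes A :: "real^'n^'n"
  assumes psd: "psd_matrix A" and M: "schur_residual A S M"
  shows "residual_mat A S = M"
proof -
  have sym: "transpose A = A" using psd by (simp add: psd_matrix_def)
  have "residual_mat A S *v x = M *v x" for x
  proof -
    define y' where "y' = pinv (submat A S S) *v (A *v x)"
    obtain y where y: "subvec y S = y" "M *v x = A *v (x - y)"
      using schur_residualD(5)[OF M] by blast
    have y': "subvec y' S = y'" "residual_mat A S *v x = A *v (x - y')"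
      by (simp_all add: y'_def pinv_submat_supported[OF sym] residual_mat_mult_vec[OF sym]
          matrix_vector_mult_diff_distrib)
    define w where "w = y - y'"
    have "subvec (A *v (x - y)) S = 0"
      using M y(2) unfolding schur_residual_def by metis
    moreover have "subvec (A *v (x - y')) S = 0"
      using psd_matrix_pinv_submat_absorb(2)[OF psd, of S x]
      by (simp add: matrix_vector_mult_diff_distrib subvec_diff y'_def)
    ultimately have "subvec (A *v w) S = 0"
      by (simp add: w_def matrix_vector_mult_diff_distrib subvec_diff)
    then have "subvec w S \<bullet> (A *v w) = 0" by (simp add: subvec_inner)
    then have "w \<bullet> (A *v w) = 0" using y(1) y'(1) by (simp add: w_def subvec_diff)
    then have "A *v w = 0" by (rule psd_matrix_null[OF psd])
    then show ?thesis
      using y(2) y'(2) by (simp add: w_def matrix_vector_mult_diff_distrib)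
  qed
  then show ?thesis by (simp add: matrix_eq)
qed

section \<open>Diagonal sampling\<close>

lemma matrix_vector_mult_axis: "((M :: real^'n^'m) *v axis s 1) $ i = M $ i $ s"
  by (simp add: matrix_vector_mult_def axis_def if_distrib cong: if_cong)

lemma inner_axis_1: "(x :: real^'n) \<bullet> axis s 1 = x $ s" "axis s 1 \<bullet> x = x $ s"
  by (simp_all add: inner_axis inner_axis')

lemma psd_matrix_diag_nonneg:
  assumes "psd_matrix M"
  shows "0 \<le> M $ i $ i"
proof -
  have "0 \<le> axis i 1 \<bullet> (M *v axis i 1)" using assms by (simp add: psd_matrix_def)
  then show ?thesis by (simp add: inner_axis_1 matrix_vector_mult_axis)
qed

lemma psd_matrix_diag_zero:
  assumes "psd_matrix M" "M $ i $ i = 0"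
  shows "M *v axis i 1 = 0" "(M *v x) $ i = 0"
proof -
  show *: "M *v axis i 1 = 0"
    using assms by (intro psd_matrix_null) (auto simp: inner_axis_1 matrix_vector_mult_axis)
  have "(M *v x) $ i = (M *v axis i 1) \<bullet> x"
    using assms(1) symmetric_matrix_inner[of M "axis i 1" x]
    by (simp add: psd_matrix_def inner_axis_1)
  then show "(M *v x) $ i = 0" using * by simp
qed

lemma psd_matrix_trace_pos:
  assumes "psd_matrix M" "M \<noteq> 0"
  shows "0 < trace M"
proof (rule ccontr)
  assume "\<not> 0 < trace M"
  moreover have "0 \<le> trace M"
    unfolding trace_def using psd_matrix_diag_nonneg[OF assms(1)] by (intro sum_nonneg) auto
  ultimately have "trace M = 0" by simp
  then have "M $ i $ i = 0" for i
    unfolding trace_def using psd_matrix_diag_nonneg[OF assms(1)] by (simp add: sum_nonneg_eq_0_iff)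
  then have "M *v axis i 1 = 0" for i using psd_matrix_diag_zero[OF assms(1)] by blast
  then have "M $ j $ i = 0" for i j
    using matrix_vector_mult_axis[of M i j] by simp
  then show False using assms(2) by (simp add: vec_eq_iff)
qed

lemma pmf_diag_pmf:
  fixes M :: "real^'n^'n"
  assumes "psd_matrix M" "0 < (\<Sum>i\<in>D. M $ i $ i)"
  shows "pmf (diag_pmf M D) j = (if j \<in> D then M $ j $ j / (\<Sum>i\<in>D. M $ i $ i) else 0)"
  unfolding diag_pmf_def
proof (rule pmf_embed_pmf)
  let ?f = "\<lambda>j. if j \<in> D then M $ j $ j / (\<Sum>i\<in>D. M $ i $ i) else 0"
  show nn: "0 \<le> ?f j" for j
    using assms psd_matrix_diag_nonneg[OF assms(1)] by auto
  have "(\<integral>\<^sup>+ x. ennreal (?f x) \<partial>count_space UNIV) = (\<Sum>x\<in>UNIV. ennreal (?f x))"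
    by (rule nn_integral_count_space_finite) simp
  also have "\<dots> = ennreal (\<Sum>x\<in>UNIV. ?f x)" using nn by (intro sum_ennreal)
  also have "(\<Sum>x\<in>UNIV. ?f x) = (\<Sum>x\<in>D. M $ x $ x / (\<Sum>i\<in>D. M $ i $ i))"
    by (simp add: sum.If_cases)
  also have "\<dots> = 1" using assms(2) by (simp add: sum_divide_distrib[symmetric])
  finally show "(\<integral>\<^sup>+ x. ennreal (?f x) \<partial>count_space UNIV) = 1" by simp
qed

lemma set_diag_pmf:
  fixes M :: "real^'n^'n"
  assumes "psd_matrix M" "0 < (\<Sum>i\<in>D. M $ i $ i)"
  shows "set_pmf (diag_pmf M D) = {j \<in> D. M $ j $ j \<noteq> 0}"
  using assms(2) by (auto simp: set_pmf_iff pmf_diag_pmf[OF assms] split: if_splits)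

lemma expectation_diag_pmf:
  fixes M :: "real^'n^'n" and f :: "'n \<Rightarrow> real"
  assumes "psd_matrix M" "0 < (\<Sum>i\<in>D. M $ i $ i)"
  shows "measure_pmf.expectation (diag_pmf M D) f
       = (\<Sum>j\<in>D. M $ j $ j * f j) / (\<Sum>i\<in>D. M $ i $ i)"
proof -
  have "measure_pmf.expectation (diag_pmf M D) f = (\<Sum>j\<in>D. pmf (diag_pmf M D) j *\<^sub>R f j)"
    by (rule integral_measure_pmf) (auto simp: set_diag_pmf[OF assms])
  also have "\<dots> = (\<Sum>j\<in>D. M $ j $ j * f j / (\<Sum>i\<in>D. M $ i $ i))"
    by (intro sum.cong) (auto simp: pmf_diag_pmf[OF assms])
  finally show ?thesis by (simp add: sum_divide_distrib)
qed

lemma expectation_mono_finite: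
  fixes f g :: "'a \<Rightarrow> real"
  assumes "finite (set_pmf p)" "\<And>x. x \<in> set_pmf p \<Longrightarrow> f x \<le> g x"
  shows "measure_pmf.expectation p f \<le> measure_pmf.expectation p g"
  using assms by (intro integral_mono_AE integrable_measure_pmf_finite) (auto simp: AE_measure_pmf_iff)

lemma expectation_bind_finite:
  fixes h :: "'b \<Rightarrow> real"
  assumes "finite (set_pmf p)" "\<And>x. x \<in> set_pmf p \<Longrightarrow> finite (set_pmf (f x))"
  shows "measure_pmf.expectation (bind_pmf p f) h
       = measure_pmf.expectation p (\<lambda>x. measure_pmf.expectation (f x) h)"
  by (subst pmf_expectation_bind[OF assms(1) assms(2) order_refl], assumption)
     (subst integral_measure_pmf[OF assms(1)], auto simp: set_pmf_iff)

section \<open>Randomly pivoted Cholesky\<close>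

text \<open>
  Exact minimisation of the form along the coordinate \<open>s\<close>. The value at the minimiser is the form
  of the Cholesky update of \<open>M\<close>, so this single computation gives both the positivity of the
  pivoted residuals and the progress of coordinate descent.
\<close>

lemma quadratic_form_coordinate_step:
  fixes M :: "real^'n^'n"
  assumes sym: "transpose M = M" and s: "M $ s $ s \<noteq> 0"
  shows "(z - ((M *v z) $ s / M $ s $ s) *\<^sub>R axis s 1) \<bullet> (M *v (z - ((M *v z) $ s / M $ s $ s) *\<^sub>R axis s 1))
       = z \<bullet> (M *v z) - ((M *v z) $ s)\<^sup>2 / M $ s $ s"
  using quadratic_form_add_scaleR[OF sym, of z "- ((M *v z) $ s / M $ s $ s)" "axis s 1"] s
  by (simp add: inner_axis_1 matrix_vector_mult_axis field_simps power2_eq_square)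

lemma cholesky_update_mult_vec:
  fixes M :: "real^'n^'n"
  shows "cholesky_update M s *v x = M *v x - ((M *v x) $ s / M $ s $ s) *\<^sub>R (M *v axis s 1)"
proof -
  have "(cholesky_update M s *v x) $ i
      = (M *v x) $ i - ((M *v x) $ s / M $ s $ s) * M $ i $ s" for i
    by (simp add: cholesky_update_def matrix_vector_mult_def left_diff_distrib sum_subtractf
        sum_distrib_right sum_distrib_left sum_divide_distrib algebra_simps)
  then show ?thesis by (simp add: vec_eq_iff matrix_vector_mult_axis)
qed

lemma cholesky_update_quadratic_form:
  fixes M :: "real^'n^'n"
  assumes sym: "transpose M = M"
  shows "z \<bullet> (cholesky_update M s *v z) = z \<bullet> (M *v z) - ((M *v z) $ s)\<^sup>2 / M $ s $ s"
  by (simp add: cholesky_update_mult_vec inner_diff_right symmetric_matrix_inner[OF sym]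
      inner_axis_1 power2_eq_square)

lemma schur_residual_cholesky_update:
  fixes A :: "real^'n^'n"
  assumes M: "schur_residual A S M" and s: "M $ s $ s \<noteq> 0"
  shows "schur_residual A (insert s S) (cholesky_update M s)"
proof -
  have psdM: "psd_matrix M" and symM: "transpose M = M"
    and zero: "\<And>x i. i \<in> S \<Longrightarrow> (M *v x) $ i = 0"
    using schur_residualD[OF M] by blast+
  note quad = cholesky_update_quadratic_form[OF symM]
  have "transpose (cholesky_update M s) = cholesky_update M s"
    using symM by (simp add: cholesky_update_def transpose_def vec_eq_iff mult.commute)
  moreover have "0 \<le> z \<bullet> (cholesky_update M s *v z)" for z
    using psdM unfolding quad quadratic_form_coordinate_step[OF symM s, symmetric]
    by (simp add: psd_matrix_def)
  moreover have "z \<bullet> (cholesky_update M s *v z) \<le> z \<bullet> (A *v z)" for z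
  proof -
    have "0 \<le> ((M *v z) $ s)\<^sup>2 / M $ s $ s" using psd_matrix_diag_nonneg[OF psdM] by simp
    moreover have "z \<bullet> (M *v z) \<le> z \<bullet> (A *v z)" using M by (simp add: schur_residual_def)
    ultimately show ?thesis unfolding quad by linarith
  qed
  moreover have "subvec (cholesky_update M s *v x) (insert s S) = 0" for x
  proof -
    have "M $ s $ s \<noteq> 0 \<and> (i \<in> S \<longrightarrow> M $ i $ s = 0)" for i
      using s zero[of i "axis s 1"] by (simp add: matrix_vector_mult_axis)
    then show ?thesis
      using zero by (auto simp: vec_eq_iff cholesky_update_mult_vec matrix_vector_mult_axis)
  qed
  moreover have "\<exists>y. subvec y (insert s S) = y \<and> cholesky_update M s *v x = A *v (x - y)" for x
  proof -
    obtain y where y: "subvec y S = y" "M *v x = A *v (x - y)"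
      using schur_residualD(5)[OF M] by blast
    obtain y' where y': "subvec y' S = y'" "M *v axis s 1 = A *v (axis s 1 - y')"
      using schur_residualD(5)[OF M] by blast
    define t where "t = (M *v x) $ s / M $ s $ s"
    define w where "w = y + t *\<^sub>R (axis s 1 - y')"
    have supp: "y $ i = 0" "y' $ i = 0" if "i \<notin> S" for i
      using that y(1) y'(1) by (metis subvec_nth)+
    have "subvec w (insert s S) = w"
      by (auto simp: vec_eq_iff w_def supp axis_def)
    moreover have "cholesky_update M s *v x = A *v (x - w)"
    proof -
      have "cholesky_update M s *v x = A *v (x - y) - t *\<^sub>R (A *v (axis s 1 - y'))"
        unfolding cholesky_update_mult_vec t_def y(2)[symmetric] y'(2)[symmetric] ..
      then show ?thesis by (simp add: w_def algebra_simps)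
    qed
    ultimately show ?thesis by blast
  qed
  ultimately show ?thesis by (simp add: schur_residual_def psd_matrix_def)
qed

abbreviation rpcholesky_step :: "(real^'n^'n) \<times> 'n set \<Rightarrow> ((real^'n^'n) \<times> 'n set) pmf" where
  "rpcholesky_step \<equiv> (\<lambda>(M, S). if M = 0 then return_pmf (M, S)
     else map_pmf (\<lambda>s. (cholesky_update M s, insert s S)) (diag_pmf M UNIV))"

lemma finite_set_rpcholesky_step: "finite (set_pmf (rpcholesky_step p))"
  by (auto split: prod.splits)

lemma finite_set_rpcholesky_state: "finite (set_pmf (rpcholesky_state A i))"
  by (induction i) (auto simp: finite_set_rpcholesky_step)

lemma rpcholesky_state_schur_residual:
  fixes A :: "real^'n^'n"
  assumes psd: "psd_matrix A"
  shows "(M, S) \<in> set_pmf (rpcholesky_state A i) \<Longrightarrow> schur_residual A S M"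
proof (induction i arbitrary: M S)
  case 0
  have "\<exists>y. subvec y {} = y \<and> A *v x = A *v (x - y)" for x
    by (rule exI[of _ 0]) (simp add: vec_eq_iff)
  moreover have "subvec x {} = 0" for x :: "real^'n" by (simp add: vec_eq_iff)
  ultimately have "schur_residual A {} A" using psd by (simp add: schur_residual_def)
  then show ?case using 0 by simp
next
  case (Suc i)
  then obtain M0 S0 where 0: "(M0, S0) \<in> set_pmf (rpcholesky_state A i)"
    and step: "(M, S) \<in> set_pmf (rpcholesky_step (M0, S0))" by (auto split: prod.splits)
  have IH: "schur_residual A S0 M0" by (rule Suc.IH[OF 0])
  show ?case
  proof (cases "M0 = 0")
    case True
    then show ?thesis using IH step by simp
  next
    case False
    have psd0: "psd_matrix M0" using IH by (simp add: schur_residual_def)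
    have "0 < (\<Sum>i\<in>UNIV. M0 $ i $ i)"
      using psd_matrix_trace_pos[OF psd0 False] by (simp add: trace_def)
    from set_diag_pmf[OF psd0 this] show ?thesis
      using False step schur_residual_cholesky_update[OF IH] by auto
  qed
qed

text \<open>
  Weighting the rank-one correction \<open>M e_s (M e_s)\<^sup>T / M_ss\<close> by the sampling probability
  \<open>M_ss / trace M\<close> cancels the pivot entry, and the sum over \<open>s\<close> is \<open>M\<^sup>2 / trace M\<close>.
\<close>

lemma expectation_rpcholesky_step_quadratic_form:
  fixes M :: "real^'n^'n"
  assumes psd: "psd_matrix M" and "M \<noteq> 0"
  shows "measure_pmf.expectation (rpcholesky_step (M, S)) (\<lambda>(M', S'). z \<bullet> (M' *v z))
       = z \<bullet> (M *v z) - (M *v z) \<bullet> (M *v z) / trace M"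
proof -
  have sym: "transpose M = M" using psd by (simp add: psd_matrix_def)
  have tr: "0 < trace M" by (rule psd_matrix_trace_pos[OF assms])
  then have tr': "0 < (\<Sum>i\<in>UNIV. M $ i $ i)" by (simp add: trace_def)
  have "M $ s $ s * (z \<bullet> (M *v z) - ((M *v z) $ s)\<^sup>2 / M $ s $ s)
      = M $ s $ s * (z \<bullet> (M *v z)) - ((M *v z) $ s)\<^sup>2" for s
    using psd_matrix_diag_zero(2)[OF psd, of s z] by (simp add: field_simps)
  then have "(\<Sum>s\<in>UNIV. M $ s $ s * (z \<bullet> (M *v z) - ((M *v z) $ s)\<^sup>2 / M $ s $ s))
      = trace M * (z \<bullet> (M *v z)) - (M *v z) \<bullet> (M *v z)"
    by (simp add: sum_subtractf trace_def sum_distrib_right inner_vec_def power2_eq_square)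
  then show ?thesis
    using \<open>M \<noteq> 0\<close> tr
    by (simp add: cholesky_update_quadratic_form[OF sym] expectation_diag_pmf[OF psd tr']
        trace_def[symmetric] diff_divide_distrib)
qed

section \<open>The expected trace of the residual\<close>

text \<open>
  The recursion is an explicit Euler scheme for \<open>\<alpha>' = - \<alpha>\<^sup>2 / (r (\<alpha> + \<beta>))\<close>, along whose
  solutions \<open>V x = ln x - \<beta> / x\<close> decreases with constant speed \<open>1 / r\<close>. As \<open>V\<close> is increasing and
  concave, the discrete steps decrease it at least as fast. Here \<open>T\<close> stands for the initial
  trace, and the lower bound on \<open>d\<close> is \<open>r\<close> times a bound for the distance from \<open>V (\<alpha> 0)\<close> down to
  \<open>V (\<delta> \<beta>)\<close>.
\<close>

lemma potential_recursion:
  fixes \<alpha> :: "nat \<Rightarrow> real"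
  assumes \<beta>: "0 < \<beta>" and \<delta>: "0 < \<delta>" and r: "0 < r"
    and init: "\<alpha> 0 + \<beta> \<le> T"
    and step: "\<And>k. \<alpha> (Suc k) \<le> \<alpha> k - (\<alpha> k)\<^sup>2 / (r * (\<alpha> k + \<beta>))"
    and nonneg: "\<And>k. 0 \<le> \<alpha> k"
    and d: "r / \<delta> + r * ln (T / (\<delta> * \<beta>)) \<le> real d"
  shows "\<alpha> d \<le> \<delta> * \<beta>"
proof (rule ccontr)
  assume "\<not> \<alpha> d \<le> \<delta> * \<beta>"
  then have big: "\<delta> * \<beta> < \<alpha> d" by simp
  have "decseq \<alpha>"
  proof (rule decseq_SucI)
    fix k
    have "0 \<le> (\<alpha> k)\<^sup>2 / (r * (\<alpha> k + \<beta>))" using r \<beta> nonneg[of k] by simp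
    then show "\<alpha> (Suc k) \<le> \<alpha> k" using step[of k] by linarith
  qed
  then have mono: "\<alpha> d \<le> \<alpha> k" if "k \<le> d" for k using that by (simp add: decseqD)
  have pos: "0 < \<alpha> k" if "k \<le> d" for k
    using mono[OF that] big \<beta> \<delta> by (meson less_le_trans less_trans mult_pos_pos)
  define V where "V x = ln x - \<beta> / x" for x
  have V_step: "V (\<alpha> (Suc k)) \<le> V (\<alpha> k) - 1 / r" if "Suc k \<le> d" for k
  proof -
    define x where "x = \<alpha> k"
    define y where "y = \<alpha> (Suc k)"
    have x: "0 < x" and y: "0 < y" using pos[of k] pos[of "Suc k"] that by (auto simp: x_def y_def)
    have yx: "y \<le> x" using \<open>decseq \<alpha>\<close> by (simp add: x_def y_def decseqD)
    have "ln y - ln x \<le> y / x - 1"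
      using ln_le_minus_one[of "y / x"] x y by (simp add: ln_div)
    moreover have "\<beta> / x - \<beta> / y \<le> - (\<beta> * (x - y) / x\<^sup>2)"
    proof -
      have "(x - y) / (x * x) \<le> (x - y) / (x * y)"
        using x y yx by (intro divide_left_mono mult_left_mono) auto
      moreover have "1 / y - 1 / x = (x - y) / (x * y)" using x y by (simp add: field_simps)
      ultimately have "(x - y) / x\<^sup>2 \<le> 1 / y - 1 / x" by (simp add: power2_eq_square)
      then have "\<beta> * ((x - y) / x\<^sup>2) \<le> \<beta> * (1 / y - 1 / x)" using \<beta> by (intro mult_left_mono) auto
      then show ?thesis by (simp add: right_diff_distrib diff_divide_distrib)
    qed
    ultimately have "V y - V x \<le> (y / x - 1) - \<beta> * (x - y) / x\<^sup>2" by (simp add: V_def)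
    also have "\<dots> = - ((x + \<beta>) / x\<^sup>2) * (x - y)" using x by (simp add: field_simps power2_eq_square)
    also have "\<dots> \<le> - ((x + \<beta>) / x\<^sup>2) * (x\<^sup>2 / (r * (x + \<beta>)))"
    proof (rule mult_left_mono_neg)
      show "x\<^sup>2 / (r * (x + \<beta>)) \<le> x - y" using step[of k] by (simp add: x_def y_def)
      show "- ((x + \<beta>) / x\<^sup>2) \<le> 0" using x \<beta> by simp
    qed
    also have "\<dots> = - 1 / r" proof -
      have cancel: "- (u / w) * (w / (r * u)) = - 1 / r" if "u \<noteq> 0" "w \<noteq> 0" for u w
        using that r by (simp add: field_simps)
      show ?thesis by (rule cancel) (use x \<beta> in auto)
    qed
    finally show ?thesis by (simp add: x_def y_def)
  qed
  have "k \<le> d \<Longrightarrow> V (\<alpha> k) \<le> V (\<alpha> 0) - k / r" for k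
  proof (induction k)
    case (Suc k)
    then show ?case using V_step[of k] by (simp add: add_divide_distrib)
  qed simp
  then have "real d / r \<le> V (\<alpha> 0) - V (\<alpha> d)" by (simp add: algebra_simps)
  moreover have "V (\<alpha> 0) < ln T"
  proof -
    have "ln (\<alpha> 0) \<le> ln T" using pos[of 0] init \<beta> by (subst ln_le_cancel_iff) auto
    moreover have "0 < \<beta> / \<alpha> 0" using pos[of 0] \<beta> by simp
    ultimately show ?thesis by (simp add: V_def)
  qed
  moreover have "V (\<alpha> d) > ln (\<delta> * \<beta>) - 1 / \<delta>"
  proof -
    have "ln (\<delta> * \<beta>) < ln (\<alpha> d)" using big \<beta> \<delta> pos[of d] by (subst ln_less_cancel_iff) auto
    moreover have "\<beta> / \<alpha> d \<le> \<beta> / (\<delta> * \<beta>)"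
      using big \<beta> \<delta> pos[of d] by (intro divide_left_mono) auto
    ultimately show ?thesis using \<beta> by (simp add: V_def)
  qed
  ultimately have "real d / r < ln T - (ln (\<delta> * \<beta>) - 1 / \<delta>)" by linarith
  moreover have "0 < T" using pos[of 0] init \<beta> by simp
  ultimately have "real d / r < 1 / \<delta> + ln (T / (\<delta> * \<beta>))"
    using \<beta> \<delta> by (simp add: ln_div)
  then have "real d < r / \<delta> + r * ln (T / (\<delta> * \<beta>))"
    using r by (simp add: field_simps)
  then show False using d by simp
qed

text \<open>
  The decrease of \<open>a\<close> is at least \<open>a\<^sup>2 / (r trace M)\<close>. It is stated in the linearised form coming
  from \<open>a\<^sup>2 / w \<ge> 2 t a - t\<^sup>2 w\<close>, valid for every \<open>t\<close>: being affine in \<open>a\<close>, this bound can be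
  averaged over the random matrix \<open>M\<close>, which makes it a substitute for Jensen's inequality.
\<close>

lemma rpcholesky_head_one_step:
  fixes M A :: "real^'n^'n" and I :: "'n set"
  assumes eb: "eigenbasis A q c" and M: "schur_residual A S M" and I: "I \<noteq> {}"
    and \<beta>: "(\<Sum>i\<in>-I. q i \<bullet> (A *v q i)) \<le> \<beta>" and "0 \<le> \<beta>"
  shows "measure_pmf.expectation (rpcholesky_step (M, S)) (\<lambda>(M', S'). \<Sum>i\<in>I. q i \<bullet> (M' *v q i))
    \<le> (\<Sum>i\<in>I. q i \<bullet> (M *v q i))
      - (2 * t * (\<Sum>i\<in>I. q i \<bullet> (M *v q i)) - t\<^sup>2 * ((\<Sum>i\<in>I. q i \<bullet> (M *v q i)) + \<beta>)) / card I"
proof (cases "M = 0")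
  case True
  then show ?thesis using I \<open>0 \<le> \<beta>\<close> by simp
next
  case False
  define a where "a = (\<Sum>i\<in>I. q i \<bullet> (M *v q i))"
  have psd: "psd_matrix M" using M by (simp add: schur_residual_def)
  have tr: "0 < trace M" by (rule psd_matrix_trace_pos[OF psd False])
  have card: "0 < real (card I)" using I by (simp add: card_gt_0_iff)
  have tr_le: "trace M \<le> a + \<beta>"
  proof -
    have "trace M = a + (\<Sum>i\<in>-I. q i \<bullet> (M *v q i))"
      unfolding eigenbasis_trace[OF eb, of M] a_def
      by (subst sum.union_disjoint[symmetric]) (auto intro: sum.cong)
    moreover have "(\<Sum>i\<in>-I. q i \<bullet> (M *v q i)) \<le> (\<Sum>i\<in>-I. q i \<bullet> (A *v q i))"
      using M by (intro sum_mono) (simp add: schur_residual_def)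
    ultimately show ?thesis using \<beta> by simp
  qed
  have "a\<^sup>2 \<le> (\<Sum>i\<in>I. (q i \<bullet> (M *v q i))\<^sup>2) * card I"
    unfolding a_def using sum_squared_le_sum_of_squares[of "\<lambda>i. q i \<bullet> (M *v q i)" I]
    by (simp add: mult.commute)
  also have "(\<Sum>i\<in>I. (q i \<bullet> (M *v q i))\<^sup>2) \<le> (\<Sum>i\<in>I. (M *v q i) \<bullet> (M *v q i))"
  proof (rule sum_mono)
    fix i
    have "(q i \<bullet> (M *v q i))\<^sup>2 \<le> (q i \<bullet> q i) * ((M *v q i) \<bullet> (M *v q i))"
      by (rule Cauchy_Schwarz_ineq)
    then show "(q i \<bullet> (M *v q i))\<^sup>2 \<le> (M *v q i) \<bullet> (M *v q i)"
      using eb by (simp add: eigenbasis_def)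
  qed
  finally have sq: "a\<^sup>2 / card I \<le> (\<Sum>i\<in>I. (M *v q i) \<bullet> (M *v q i))"
    using card by (simp add: field_simps mult_right_mono)
  have "2 * t * a - t\<^sup>2 * (a + \<beta>) \<le> 2 * t * a - t\<^sup>2 * trace M"
    using tr_le by (simp add: mult_left_mono)
  also have "\<dots> \<le> a\<^sup>2 / trace M"
  proof -
    have "0 \<le> (a - t * trace M)\<^sup>2 / trace M" using tr by simp
    also have "\<dots> = a\<^sup>2 / trace M - (2 * t * a - t\<^sup>2 * trace M)"
      using tr by (simp add: field_simps power2_eq_square)
    finally show ?thesis by simp
  qed
  finally have "(2 * t * a - t\<^sup>2 * (a + \<beta>)) / card I \<le> (a\<^sup>2 / trace M) / card I"
    using card by (intro divide_right_mono) auto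
  also have "\<dots> = (a\<^sup>2 / card I) / trace M" by simp
  also have "\<dots> \<le> (\<Sum>i\<in>I. (M *v q i) \<bullet> (M *v q i)) / trace M"
    using sq tr by (intro divide_right_mono) auto
  finally have main: "(2 * t * a - t\<^sup>2 * (a + \<beta>)) / card I \<le> \<dots>" .
  have "measure_pmf.expectation (rpcholesky_step (M, S)) (\<lambda>(M', S'). \<Sum>i\<in>I. q i \<bullet> (M' *v q i))
      = (\<Sum>i\<in>I. measure_pmf.expectation (rpcholesky_step (M, S)) (\<lambda>(M', S'). q i \<bullet> (M' *v q i)))"
    unfolding case_prod_unfold
    by (rule Bochner_Integration.integral_sum)
       (intro integrable_measure_pmf_finite, use finite_set_rpcholesky_step[of "(M, S)"] in \<open>simp add: case_prod_unfold\<close>)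
  also have "\<dots> = a - (\<Sum>i\<in>I. (M *v q i) \<bullet> (M *v q i)) / trace M"
    unfolding expectation_rpcholesky_step_quadratic_form[OF psd False]
    by (simp add: sum_subtractf a_def sum_divide_distrib)
  finally show ?thesis using main by (simp add: a_def)
qed

text \<open>
  The slope \<open>t\<close> of the linearised bound may depend on the mean \<open>\<alpha> k\<close> but not on the random matrix;
  the choice \<open>\<alpha> k / (\<alpha> k + \<beta>)\<close> makes the averaged bound tight.
\<close>

lemma rpcholesky_expected_head:
  fixes A :: "real^'n^'n" and I :: "'n set" and \<alpha> :: "nat \<Rightarrow> real"
  assumes psd: "psd_matrix A" and eb: "eigenbasis A q c" and I: "I \<noteq> {}"
    and \<beta>: "(\<Sum>i\<in>-I. q i \<bullet> (A *v q i)) \<le> \<beta>" "0 < \<beta>"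
  defines "\<alpha> \<equiv> \<lambda>k. measure_pmf.expectation (rpcholesky_state A k) (\<lambda>(M, S). \<Sum>i\<in>I. q i \<bullet> (M *v q i))"
  shows "0 \<le> \<alpha> k" and "\<alpha> (Suc k) \<le> \<alpha> k - (\<alpha> k)\<^sup>2 / (card I * (\<alpha> k + \<beta>))"
proof -
  note fin = finite_set_rpcholesky_state[of A]
  have int: "integrable (rpcholesky_state A k) f" for k and f :: "_ \<Rightarrow> real"
    using fin by (rule integrable_measure_pmf_finite)
  note inv = rpcholesky_state_schur_residual[OF psd]
  define a where "a = (\<lambda>(M, S :: 'n set). \<Sum>i\<in>I. q i \<bullet> (M *v q i))"
  have card: "0 < real (card I)" using I by (simp add: card_gt_0_iff)
  have nonneg: "0 \<le> \<alpha> k" for k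
  proof -
    have "measure_pmf.expectation (rpcholesky_state A k) (\<lambda>_. 0) \<le> \<alpha> k"
      unfolding \<alpha>_def using inv
      by (intro expectation_mono_finite fin)
         (auto simp: schur_residual_def psd_matrix_def split: prod.splits intro!: sum_nonneg)
    then show ?thesis by simp
  qed
  then show "0 \<le> \<alpha> k" .
  define t where "t = \<alpha> k / (\<alpha> k + \<beta>)"
  have "\<alpha> (Suc k) = measure_pmf.expectation (rpcholesky_state A k)
      (\<lambda>p. measure_pmf.expectation (rpcholesky_step p) a)"
    unfolding \<alpha>_def rpcholesky_state.simps a_def
    by (intro expectation_bind_finite fin finite_set_rpcholesky_step)
  also have "\<dots> \<le> measure_pmf.expectation (rpcholesky_state A k)
      (\<lambda>p. a p - (2 * t * a p - t\<^sup>2 * (a p + \<beta>)) / card I)"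
  proof (intro expectation_mono_finite fin)
    fix p assume "p \<in> set_pmf (rpcholesky_state A k)"
    then show "measure_pmf.expectation (rpcholesky_step p) a
        \<le> a p - (2 * t * a p - t\<^sup>2 * (a p + \<beta>)) / card I"
      using rpcholesky_head_one_step[OF eb inv I \<beta>(1), of "fst p" "snd p" k t] \<beta>(2)
      by (cases p) (simp add: a_def)
  qed
  also have "\<dots> = \<alpha> k - (2 * t * \<alpha> k - t\<^sup>2 * (\<alpha> k + \<beta>)) / card I"
    using int by (simp add: \<alpha>_def a_def[symmetric])
  also have "2 * t * \<alpha> k - t\<^sup>2 * (\<alpha> k + \<beta>) = (\<alpha> k)\<^sup>2 / (\<alpha> k + \<beta>)"
  proof -
    have pos: "0 < \<alpha> k + \<beta>" using nonneg[of k] \<beta>(2) by simp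
    then have "t * (\<alpha> k + \<beta>) = \<alpha> k" by (simp add: t_def)
    then have "t\<^sup>2 * (\<alpha> k + \<beta>) = t * \<alpha> k" by (simp add: power2_eq_square mult.assoc)
    moreover have "t * \<alpha> k = (\<alpha> k)\<^sup>2 / (\<alpha> k + \<beta>)" by (simp add: t_def power2_eq_square)
    ultimately show ?thesis by simp
  qed
  finally show "\<alpha> (Suc k) \<le> \<alpha> k - (\<alpha> k)\<^sup>2 / (card I * (\<alpha> k + \<beta>))"
    by (simp add: mult.commute)
qed

text \<open>
  Splitting the trace along the eigenbasis, the leading part has mean at most \<open>\<delta>\<close> times the tail
  and the remaining part is at most the tail. If \<open>r = 0\<close>, the leading part is empty.
\<close>

theorem rpcholesky_expected_trace:
  fixes A :: "real^'n^'n"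
  assumes psd: "psd_matrix A" and \<delta>: "0 < \<delta>" and eta: "0 < eta A r"
    and d: "real d \<ge> real r / \<delta> + real r * ln (1 / (\<delta> * eta A r))"
  shows "0 < tail_sum A r" "0 < trace A"
    and "measure_pmf.expectation (rpcholesky A d) (\<lambda>S. trace (residual_mat A S))
         \<le> (1 + \<delta>) * tail_sum A r"
proof -
  have sym: "transpose A = A" using psd by (simp add: psd_matrix_def)
  obtain q c where eb: "eigenbasis A q c" using symmetric_eigenbasis_exists[OF sym] by blast
  have "r \<le> CARD('n)"
  proof (rule ccontr)
    assume "\<not> r \<le> CARD('n)"
    then have "tail_sum A r = 0" by (simp add: tail_sum_def)
    then show False using eta by (simp add: eta_def)
  qed
  then obtain I where I: "card I = r" "tail_sum A r = (\<Sum>i\<in>- I. c i)"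
    and total: "(\<Sum>i\<in>{1..CARD('n)}. eigval A i) = (\<Sum>i\<in>UNIV. c i)"
    using eigval_sums[OF eb] by blast
  have qA: "q i \<bullet> (A *v q i) = c i" for i using eb by (simp add: eigenbasis_def)
  have trA: "trace A = (\<Sum>i\<in>UNIV. c i)" by (simp add: eigenbasis_trace[OF eb] qA)
  define \<beta> where "\<beta> = tail_sum A r"
  have "0 \<le> trace A" "0 \<le> \<beta>" unfolding trA \<beta>_def I(2)
    using psd_eigenvalues_nonneg[OF psd eb] by (auto intro: sum_nonneg)
  moreover have eta_eq: "eta A r = \<beta> / trace A" unfolding eta_def \<beta>_def total trA ..
  ultimately have \<beta>: "0 < \<beta>" and tr: "0 < trace A"
    using eta by (auto simp: zero_less_divide_iff)
  then show "0 < tail_sum A r" "0 < trace A" by (simp_all add: \<beta>_def)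
  define \<alpha> where "\<alpha> k = measure_pmf.expectation (rpcholesky_state A k)
      (\<lambda>(M, S). \<Sum>i\<in>I. q i \<bullet> (M *v q i))" for k
  note fin = finite_set_rpcholesky_state[of A]
  note inv = rpcholesky_state_schur_residual[OF psd]
  have tail: "(\<Sum>i\<in>-I. q i \<bullet> (A *v q i)) \<le> \<beta>" by (simp add: qA I(2) \<beta>_def)
  have head: "\<alpha> d \<le> \<delta> * \<beta>"
  proof (cases "I = {}")
    case True
    then show ?thesis using \<beta> \<delta> by (simp add: \<alpha>_def case_prod_unfold)
  next
    case False
    then have r: "0 < real r" using I(1) by (auto simp: card_gt_0_iff)
    note rec = rpcholesky_expected_head[OF psd eb False tail \<beta>, folded \<alpha>_def, unfolded I(1)]
    show ?thesis
    proof (rule potential_recursion[OF \<beta> \<delta> r, where T = "trace A"])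
      show "\<alpha> 0 + \<beta> \<le> trace A"
        by (simp add: \<alpha>_def qA \<beta>_def I(2) trA) (subst sum.union_disjoint[symmetric], auto)
      show "real r / \<delta> + real r * ln (trace A / (\<delta> * \<beta>)) \<le> real d"
        using d by (simp add: eta_eq)
    qed (use rec in auto)
  qed
  have "measure_pmf.expectation (rpcholesky A d) (\<lambda>S. trace (residual_mat A S))
      = measure_pmf.expectation (rpcholesky_state A d) (\<lambda>(M, S). trace (residual_mat A S))"
    by (simp add: rpcholesky_def case_prod_unfold)
  also have "\<dots> \<le> measure_pmf.expectation (rpcholesky_state A d)
      (\<lambda>p. (\<lambda>(M, S). \<Sum>i\<in>I. q i \<bullet> (M *v q i)) p + \<beta>)"
  proof (intro expectation_mono_finite fin)
    fix p assume p: "p \<in> set_pmf (rpcholesky_state A d)"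
    obtain M S where MS: "p = (M, S)" by (cases p)
    have M: "schur_residual A S M" using inv p MS by blast
    have "trace M = (\<Sum>i\<in>I. q i \<bullet> (M *v q i)) + (\<Sum>i\<in>-I. q i \<bullet> (M *v q i))"
      unfolding eigenbasis_trace[OF eb, of M]
      by (subst sum.union_disjoint[symmetric]) (auto intro: sum.cong)
    moreover have "(\<Sum>i\<in>-I. q i \<bullet> (M *v q i)) \<le> (\<Sum>i\<in>-I. q i \<bullet> (A *v q i))"
      using M by (intro sum_mono) (simp add: schur_residual_def)
    ultimately show "(case p of (M, S) \<Rightarrow> trace (residual_mat A S))
        \<le> (case p of (M, S) \<Rightarrow> \<Sum>i\<in>I. q i \<bullet> (M *v q i)) + \<beta>"
      using tail schur_residual_unique[OF psd M] by (simp add: MS)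
  qed
  also have "\<dots> = \<alpha> d + \<beta>"
    unfolding \<alpha>_def by (subst Bochner_Integration.integral_add)
      (auto intro: integrable_measure_pmf_finite[OF fin])
  finally show "measure_pmf.expectation (rpcholesky A d) (\<lambda>S. trace (residual_mat A S))
      \<le> (1 + \<delta>) * tail_sum A r"
    using head by (simp add: \<beta>_def algebra_simps)
qed

lemma rpcholesky_trace_markov:
  fixes A :: "real^'n^'n"
  assumes psd: "psd_matrix A" and \<rho>: "0 < \<rho>" and B: "0 < B"
    and mean: "measure_pmf.expectation (rpcholesky A d) (\<lambda>S. trace (residual_mat A S)) \<le> B"
  shows "1 - \<rho> \<le> measure_pmf.prob (rpcholesky A d) {S. trace (residual_mat A S) \<le> inverse \<rho> * B}"
proof -
  let ?p = "rpcholesky A d" and ?t = "\<lambda>S. trace (residual_mat A S)"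
  have nonneg: "0 \<le> ?t S" if S: "S \<in> set_pmf ?p" for S
  proof -
    obtain M where "(M, S) \<in> set_pmf (rpcholesky_state A d)"
      using S by (auto simp: rpcholesky_def)
    then have M: "schur_residual A S M" by (rule rpcholesky_state_schur_residual[OF psd])
    then have "0 \<le> trace M"
      unfolding trace_def by (intro sum_nonneg psd_matrix_diag_nonneg) (simp add: schur_residual_def)
    then show ?thesis using schur_residual_unique[OF psd M] by simp
  qed
  have "measure_pmf.prob ?p (- {S. ?t S \<le> inverse \<rho> * B})
      \<le> measure_pmf.prob ?p {S \<in> space ?p. inverse \<rho> * B \<le> ?t S}"
    by (intro measure_pmf.finite_measure_mono) auto
  also have "\<dots> \<le> measure_pmf.expectation ?p ?t / (inverse \<rho> * B)"
  proof (rule integral_Markov_inequality_measure[where A = "{}"])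
    show "integrable ?p ?t" by (rule integrable_measure_pmf_finite) simp
    show "AE S in ?p. 0 \<le> ?t S" using nonneg by (simp add: AE_measure_pmf_iff)
    show "0 < inverse \<rho> * B" using \<rho> B by simp
  qed simp
  also have "\<dots> \<le> B / (inverse \<rho> * B)" using mean \<rho> B by (intro divide_right_mono) auto
  also have "\<dots> = \<rho>" using B by (simp add: field_simps)
  finally show ?thesis
    using measure_pmf.prob_compl[of "{S. ?t S \<le> inverse \<rho> * B}" ?p] by (simp add: Compl_eq_Diff_UNIV)
qed

section \<open>Coordinate descent on the residual\<close>

text \<open>
  Eliminating the variables in \<open>S\<close> replaces \<open>x\<close> by \<open>x - y\<close> with \<open>R x = A (x - y)\<close>. As \<open>R x\<close>
  vanishes on \<open>S\<close>, the energy of \<open>x - y\<close> for \<open>A\<close> is that of \<open>x\<close> for \<open>R\<close>, so the spectral gap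
  of \<open>A\<close> is inherited by \<open>R\<close>.
\<close>

lemma schur_residual_gradient_bound:
  fixes A :: "real^'n^'n"
  assumes psd: "psd_matrix A" and R: "schur_residual A S R"
  shows "min_nonzero_eigval A * (x \<bullet> (R *v x)) \<le> (R *v x) \<bullet> (R *v x)"
proof -
  obtain y where y: "subvec y S = y" "R *v x = A *v (x - y)"
    using schur_residualD(5)[OF R] by blast
  have "subvec (R *v x) S = 0" using R by (simp add: schur_residual_def)
  then have "y \<bullet> (R *v x) = 0" using subvec_inner[of y S "R *v x"] y(1) by simp
  then have "(x - y) \<bullet> (A *v (x - y)) = x \<bullet> (R *v x)"
    by (simp add: y(2)[symmetric] inner_diff_left)
  then show ?thesis
    using min_nonzero_eigval_gradient_bound[OF psd, of "x - y"] y(2) by simp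
qed

lemma min_nonzero_eigval_nonneg:
  fixes A :: "real^'n^'n"
  assumes psd: "psd_matrix A" and "A \<noteq> 0"
  shows "0 \<le> min_nonzero_eigval A"
proof -
  have "transpose A = A" using psd by (simp add: psd_matrix_def)
  then obtain q c where eb: "eigenbasis A q c" using symmetric_eigenbasis_exists by blast
  obtain xs where xs: "set xs = (UNIV :: 'n set)" "eigvals_desc A = map c xs"
    using eigvals_desc_enumeration[OF eb] by blast
  have "\<exists>i. c i \<noteq> 0"
  proof (rule ccontr)
    assume "\<nexists>i. c i \<noteq> 0"
    then have "trace A = 0" using eb by (simp add: eigenbasis_trace[OF eb] eigenbasis_def)
    then show False using psd_matrix_trace_pos[OF assms] by simp
  qed
  then have "{x \<in> set (eigvals_desc A). x \<noteq> 0} \<noteq> {}" using xs by auto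
  then have "min_nonzero_eigval A \<in> {x \<in> set (eigvals_desc A). x \<noteq> 0}"
    unfolding min_nonzero_eigval_def by (intro Min_in) auto
  then show ?thesis using xs psd_eigenvalues_nonneg[OF psd eb] by auto
qed

definition coordinate_step :: "real^'n^'n \<Rightarrow> 'n \<Rightarrow> real^'n \<Rightarrow> real^'n" where
  "coordinate_step R j e = e - ((R *v e) $ j / R $ j $ j) *\<^sub>R axis j 1"

text \<open>
  Sampling \<open>j\<close> with weight \<open>R_jj\<close> cancels the denominator of the gain \<open>(R e)_j\<^sup>2 / R_jj\<close>, and the
  mean gain is \<open>R e \<bullet> R e / trace R\<close>.
\<close>

lemma coordinate_step_expectation:
  fixes R :: "real^'n^'n"
  assumes psd: "psd_matrix R" and R: "R \<noteq> 0" and D: "\<And>i. i \<notin> D \<Longrightarrow> R $ i $ i = 0"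
    and grad: "\<mu> * (e \<bullet> (R *v e)) \<le> (R *v e) \<bullet> (R *v e)" and lam: "0 \<le> \<mu>"
    and \<tau>: "trace R \<le> \<tau>"
  shows "measure_pmf.expectation (diag_pmf R D)
           (\<lambda>j. coordinate_step R j e \<bullet> (R *v coordinate_step R j e))
         \<le> (1 - \<mu> / \<tau>) * (e \<bullet> (R *v e))"
proof -
  have sym: "transpose R = R" using psd by (simp add: psd_matrix_def)
  have sumD: "(\<Sum>i\<in>D. f i) = (\<Sum>i\<in>UNIV. f i)" if "\<And>i. i \<notin> D \<Longrightarrow> f i = 0" for f :: "'n \<Rightarrow> real"
    using that by (intro sum.mono_neutral_left) auto
  have trD: "(\<Sum>i\<in>D. R $ i $ i) = trace R" using sumD[OF D] by (simp add: trace_def)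
  have tr: "0 < trace R" by (rule psd_matrix_trace_pos[OF psd R])
  have h: "0 \<le> e \<bullet> (R *v e)" using psd by (simp add: psd_matrix_def)
  have "R $ j $ j * (coordinate_step R j e \<bullet> (R *v coordinate_step R j e))
      = R $ j $ j * (e \<bullet> (R *v e)) - ((R *v e) $ j)\<^sup>2" for j
  proof (cases "R $ j $ j = 0")
    case True
    then show ?thesis using psd_matrix_diag_zero(2)[OF psd True, of e] by simp
  next
    case False
    then show ?thesis
      unfolding coordinate_step_def quadratic_form_coordinate_step[OF sym False]
      by (simp add: field_simps)
  qed
  then have "(\<Sum>j\<in>D. R $ j $ j * (coordinate_step R j e \<bullet> (R *v coordinate_step R j e)))
      = trace R * (e \<bullet> (R *v e)) - (\<Sum>j\<in>D. ((R *v e) $ j)\<^sup>2)"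
    by (simp add: sum_subtractf sum_distrib_right[symmetric] trD)
  also have "(\<Sum>j\<in>D. ((R *v e) $ j)\<^sup>2) = (R *v e) \<bullet> (R *v e)"
    using psd_matrix_diag_zero(2)[OF psd D]
    by (subst sumD) (simp_all add: inner_vec_def power2_eq_square)
  finally have "measure_pmf.expectation (diag_pmf R D)
           (\<lambda>j. coordinate_step R j e \<bullet> (R *v coordinate_step R j e))
      = e \<bullet> (R *v e) - (R *v e) \<bullet> (R *v e) / trace R"
    using tr by (simp add: expectation_diag_pmf[OF psd] trD diff_divide_distrib)
  also have "\<dots> \<le> e \<bullet> (R *v e) - \<mu> * (e \<bullet> (R *v e)) / \<tau>"
  proof -
    have "\<mu> * (e \<bullet> (R *v e)) / \<tau> \<le> \<mu> * (e \<bullet> (R *v e)) / trace R"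
      using tr \<tau> lam h by (intro divide_left_mono mult_nonneg_nonneg mult_pos_pos) auto
    also have "\<dots> \<le> (R *v e) \<bullet> (R *v e) / trace R"
      using grad tr by (intro divide_right_mono) auto
    finally show ?thesis by simp
  qed
  finally show ?thesis by (simp add: algebra_simps)
qed

lemma finite_set_replicate_pmf:
  assumes "finite (set_pmf p)"
  shows "finite (set_pmf (replicate_pmf n p))"
proof -
  have "set_pmf (replicate_pmf n p) \<subseteq> {xs. set xs \<subseteq> set_pmf p \<and> length xs = n}"
    by (auto simp: set_replicate_pmf)
  then show ?thesis using finite_lists_length_eq[OF assms] finite_subset by blast
qed

text \<open>
  The contraction factor is nonnegative because a mean of nonnegative energies is at most this
  factor times a positive energy. Without this the one-step estimates could not be multiplied.
\<close>

lemma sequential_coordinate_steps_expectation: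
  fixes R :: "real^'n^'n"
  assumes psd: "psd_matrix R" and R: "R \<noteq> 0" and D: "\<And>i. i \<notin> D \<Longrightarrow> R $ i $ i = 0"
    and grad: "\<And>e. \<mu> * (e \<bullet> (R *v e)) \<le> (R *v e) \<bullet> (R *v e)" and lam: "0 \<le> \<mu>"
    and \<tau>: "trace R \<le> \<tau>"
  shows "0 \<le> 1 - \<mu> / \<tau>"
    and "measure_pmf.expectation (replicate_pmf l (diag_pmf R D))
           (\<lambda>js. fold (coordinate_step R) js e \<bullet> (R *v fold (coordinate_step R) js e))
         \<le> (1 - \<mu> / \<tau>) ^ l * (e \<bullet> (R *v e))"
proof -
  note step = coordinate_step_expectation[OF psd R D grad lam \<tau>]
  have nonneg: "0 \<le> e \<bullet> (R *v e)" for e using psd by (simp add: psd_matrix_def)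
  show q: "0 \<le> 1 - \<mu> / \<tau>"
  proof -
    have "\<exists>i. R $ i $ i \<noteq> 0"
    proof (rule ccontr)
      assume "\<nexists>i. R $ i $ i \<noteq> 0"
      then have "trace R = 0" by (simp add: trace_def)
      then show False using psd_matrix_trace_pos[OF psd R] by simp
    qed
    then obtain i where "R $ i $ i \<noteq> 0" ..
    then have "0 < axis i 1 \<bullet> (R *v axis i 1)"
      using psd_matrix_diag_nonneg[OF psd, of i]
      by (simp add: inner_axis_1 matrix_vector_mult_axis)
    moreover have "0 \<le> (1 - \<mu> / \<tau>) * (axis i 1 \<bullet> (R *v axis i 1))"
      by (rule order_trans[OF _ step]) (simp add: nonneg)
    ultimately show ?thesis by (simp add: zero_le_mult_iff)
  qed
  have fin: "finite (set_pmf (replicate_pmf l (diag_pmf R D)))" for l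
    by (rule finite_set_replicate_pmf) simp
  show "measure_pmf.expectation (replicate_pmf l (diag_pmf R D))
           (\<lambda>js. fold (coordinate_step R) js e \<bullet> (R *v fold (coordinate_step R) js e))
         \<le> (1 - \<mu> / \<tau>) ^ l * (e \<bullet> (R *v e))"
  proof (induction l arbitrary: e)
    case (Suc l)
    let ?h = "\<lambda>js e. fold (coordinate_step R) js e \<bullet> (R *v fold (coordinate_step R) js e)"
    have "measure_pmf.expectation (replicate_pmf (Suc l) (diag_pmf R D)) (\<lambda>js. ?h js e)
        = measure_pmf.expectation (diag_pmf R D) (\<lambda>j.
            measure_pmf.expectation (replicate_pmf l (diag_pmf R D)) (\<lambda>js. ?h js (coordinate_step R j e)))"
      by (simp add: expectation_bind_finite fin map_pmf_def[symmetric])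
    also have "\<dots> \<le> measure_pmf.expectation (diag_pmf R D) (\<lambda>j.
        (1 - \<mu> / \<tau>) ^ l * (coordinate_step R j e \<bullet> (R *v coordinate_step R j e)))"
      by (intro expectation_mono_finite Suc.IH) simp
    also have "\<dots> = (1 - \<mu> / \<tau>) ^ l * measure_pmf.expectation (diag_pmf R D) (\<lambda>j.
        coordinate_step R j e \<bullet> (R *v coordinate_step R j e))" by simp
    also have "\<dots> \<le> (1 - \<mu> / \<tau>) ^ l * ((1 - \<mu> / \<tau>) * (e \<bullet> (R *v e)))"
      using q by (intro mult_left_mono step) auto
    finally show ?case by (simp add: mult_ac)
  qed simp
qed

lemma fold_coordinate_step_supported:
  fixes R :: "real^'n^'n"
  shows "\<exists>y. subvec y (set js) = y \<and> fold (coordinate_step R) js e = e - y"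
proof (induction js arbitrary: e)
  case Nil
  show ?case by (rule exI[of _ 0]) (simp add: vec_eq_iff)
next
  case (Cons j js)
  obtain y where y: "subvec y (set js) = y"
    "fold (coordinate_step R) js (coordinate_step R j e) = coordinate_step R j e - y"
    using Cons.IH by blast
  have "y $ i = 0" if "i \<notin> set js" for i using y(1) that by (metis subvec_nth)
  then have "subvec (y + ((R *v e) $ j / R $ j $ j) *\<^sub>R axis j 1) (set (j # js))
      = y + ((R *v e) $ j / R $ j $ j) *\<^sub>R axis j 1"
    by (auto simp: vec_eq_iff axis_def)
  moreover have "fold (coordinate_step R) (j # js) e
      = e - (y + ((R *v e) $ j / R $ j $ j) *\<^sub>R axis j 1)"
    using y(2) by (simp add: coordinate_step_def)
  ultimately show ?case by blast
qed

text \<open>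
  After the block step the gradient vanishes on the block, so the block step minimises the form
  over all corrections supported there. In particular it beats any sequence of one-coordinate steps
  inside the block.
\<close>

lemma block_step_optimal:
  fixes R :: "real^'n^'n" and e y :: "real^'n"
  assumes psd: "psd_matrix R" and y: "subvec y J = y"
  defines "\<alpha> \<equiv> pinv (submat R J J) *v (R *v e)"
  shows "(e - \<alpha>) \<bullet> (R *v (e - \<alpha>)) \<le> (e - y) \<bullet> (R *v (e - y))"
proof -
  have sym: "transpose R = R" using psd by (simp add: psd_matrix_def)
  have "subvec (R *v (e - \<alpha>)) J = 0"
    using psd_matrix_pinv_submat_absorb(2)[OF psd, of J e]
    by (simp add: \<alpha>_def matrix_vector_mult_diff_distrib subvec_diff)
  moreover have "subvec (\<alpha> - y) J = \<alpha> - y"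
    using y by (simp add: \<alpha>_def subvec_diff pinv_submat_supported[OF sym])
  ultimately have "(R *v (e - \<alpha>)) \<bullet> (\<alpha> - y) = 0"
    using subvec_inner[of "R *v (e - \<alpha>)" J "\<alpha> - y"] by simp
  moreover have "0 \<le> (\<alpha> - y) \<bullet> (R *v (\<alpha> - y))" using psd by (simp add: psd_matrix_def)
  ultimately show ?thesis
    using quadratic_form_add_scaleR[OF sym, of "e - \<alpha>" 1 "\<alpha> - y"] by simp
qed

section \<open>Subspace-constrained coordinate descent\<close>

text \<open>
  The compensation \<open>w\<close> on the pivots restores the equations indexed by \<open>S\<close>: it changes the error
  by a vector supported on \<open>S\<close>, which is orthogonal to everything in the range of \<open>R\<close>. So the
  error measured by \<open>A\<close> after the update equals the error measured by \<open>R\<close> after a plain block step.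
\<close>

lemma scrcd_update_error:
  fixes A :: "real^'n^'n"
  assumes psd: "psd_matrix A" and R: "schur_residual A S (residual_mat A S)"
    and sol: "A *v xstar = b" and J: "J \<inter> S = {}"
    and feas: "subvec (A *v (x - xstar)) S = 0"
  defines "R \<equiv> residual_mat A S" and "e \<equiv> x - xstar"
  defines "\<alpha> \<equiv> pinv (submat R J J) *v (R *v e)" and "e' \<equiv> scrcd_update A b S J x - xstar"
  shows "subvec (A *v e') S = 0"
    and "e' \<bullet> (A *v e') = (e - \<alpha>) \<bullet> (R *v (e - \<alpha>))"
    and "e \<bullet> (A *v e) = e \<bullet> (R *v e)"
proof -
  have symA: "transpose A = A" using psd by (simp add: psd_matrix_def)
  have R': "schur_residual A S R" using R by (simp add: R_def)
  note symR = schur_residualD(2)[OF R']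
  define X where "X = pinv (submat A S S)"
  note suppX = pinv_submat_supported[OF symA, of S, folded X_def]
  have Rmv: "R *v z = A *v z - A *v (X *v (A *v z))" for z
    unfolding R_def X_def by (rule residual_mat_mult_vec[OF symA])
  have "X *v (A *v e) = 0"
    using suppX(2)[of "A *v e"] feas by (simp add: e_def)
  then have Ae: "R *v e = A *v e" by (simp add: Rmv)
  then show "e \<bullet> (A *v e) = e \<bullet> (R *v e)" by simp
  define w where "w = X *v (A *v \<alpha>)"
  have supp\<alpha>: "subvec \<alpha> J = \<alpha>" by (simp add: \<alpha>_def pinv_submat_supported[OF symR])
  have suppw: "subvec w S = w" by (simp add: w_def suppX(1))
  have res: "A *v x - b = R *v e"
    unfolding Ae by (simp add: e_def sol matrix_vector_mult_diff_distrib)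
  have C: "submat (X ** submat A S UNIV) UNIV J *v \<alpha> = w"
  proof -
    have "submat (X ** submat A S UNIV) UNIV J *v \<alpha> = X *v subvec (A *v subvec \<alpha> UNIV) S"
      by (simp add: submat_mult_vec supp\<alpha> matrix_vector_mul_assoc[symmetric]) (simp add: subvec_def)
    also have "subvec \<alpha> UNIV = \<alpha>" by (simp add: vec_eq_iff)
    finally show ?thesis by (simp add: suppX(2) w_def)
  qed
  have upd: "scrcd_update A b S J x = x - \<alpha> + w"
  proof -
    have step: "pinv (submat R J J) *v subvec (A *v x - b) J = \<alpha>"
      unfolding res \<alpha>_def by (rule pinv_submat_supported(2)[OF symR])
    have "scrcd_update A b S J x
        = (\<chi> i. if i \<in> J then x $ i - \<alpha> $ i else if i \<in> S then x $ i + w $ i else x $ i)"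
      unfolding scrcd_update_def Let_def R_def[symmetric] X_def[symmetric] step C ..
    moreover have "\<alpha> $ i = 0" if "i \<notin> J" for i using supp\<alpha> that by (metis subvec_nth)
    moreover have "w $ i = 0" if "i \<notin> S" for i using suppw that by (metis subvec_nth)
    ultimately show ?thesis using J by (auto simp: vec_eq_iff)
  qed
  have e': "e' = (e - \<alpha>) + w" by (simp add: e'_def e_def upd)
  have Ae': "A *v e' = R *v (e - \<alpha>)"
    by (simp add: e' matrix_vector_right_distrib matrix_vector_mult_diff_distrib Rmv w_def)
       (use \<open>X *v (A *v e) = 0\<close> in simp)
  have zero: "subvec (R *v z) S = 0" for z using R' by (simp add: schur_residual_def)
  then show "subvec (A *v e') S = 0" by (simp add: Ae')
  have "w \<bullet> (R *v (e - \<alpha>)) = 0"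
    using subvec_inner[of w S "R *v (e - \<alpha>)"] zero suppw by simp
  then show "e' \<bullet> (A *v e') = (e - \<alpha>) \<bullet> (R *v (e - \<alpha>))"
    unfolding Ae' by (simp add: e' inner_add_left)
qed

lemma finite_set_scrcd_step: "finite (set_pmf (scrcd_step A b S l x))"
  by (simp add: scrcd_step_def finite_set_replicate_pmf)

lemma finite_set_scrcd: "finite (set_pmf (scrcd A b S l y k))"
  by (induction k) (simp_all add: finite_set_scrcd_step)

lemma energy_norm_squared:
  assumes "psd_matrix A"
  shows "(energy_norm A z)\<^sup>2 = z \<bullet> (A *v z)"
  using assms by (simp add: energy_norm_def psd_matrix_def)

context
  fixes A :: "real^'n^'n" and S :: "'n set" and xstar b :: "real^'n" and \<tau> :: real
  assumes psd: "psd_matrix A" and A0: "A \<noteq> 0" and Rres: "schur_residual A S (residual_mat A S)"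
    and sol: "A *v xstar = b" and \<tau>: "trace (residual_mat A S) \<le> \<tau>"
begin

lemma residual_diag_zero: "i \<notin> - S \<Longrightarrow> residual_mat A S $ i $ i = 0"
  using schur_residualD(4)[OF Rres, of i "axis i 1"] by (simp add: matrix_vector_mult_axis)

lemmas residual_psd = schur_residualD(1)[OF Rres]

lemmas residual_sequential_steps = sequential_coordinate_steps_expectation[where D = "- S",
    OF residual_psd _ residual_diag_zero
    schur_residual_gradient_bound[OF psd Rres] min_nonzero_eigval_nonneg[OF psd A0] \<tau>]

lemma scrcd_step_feasible:
  assumes feas: "subvec (A *v (x - xstar)) S = 0" and x': "x' \<in> set_pmf (scrcd_step A b S l x)"
  shows "subvec (A *v (x' - xstar)) S = 0"
proof (cases "residual_mat A S = 0")
  case True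
  then show ?thesis using feas x' by (simp add: scrcd_step_def)
next
  case False
  have sumpos: "0 < (\<Sum>i\<in>-S. residual_mat A S $ i $ i)"
    using psd_matrix_trace_pos[OF residual_psd False] residual_diag_zero
    unfolding trace_def by (subst sum.mono_neutral_left[of UNIV "-S"]) auto
  obtain js where js: "js \<in> set_pmf (replicate_pmf l (diag_pmf (residual_mat A S) (- S)))"
    and x'_eq: "x' = scrcd_update A b S (set js) x"
    using x' False by (auto simp: scrcd_step_def)
  have "set js \<inter> S = {}"
    using js by (auto simp: set_replicate_pmf set_diag_pmf[OF residual_psd sumpos])
  from scrcd_update_error(1)[OF psd Rres sol this feas] show ?thesis by (simp add: x'_eq)
qed

lemma scrcd_step_expectation:
  assumes feas: "subvec (A *v (x - xstar)) S = 0" and R0: "residual_mat A S \<noteq> 0"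
  shows "measure_pmf.expectation (scrcd_step A b S l x) (\<lambda>x. (x - xstar) \<bullet> (A *v (x - xstar)))
       \<le> (1 - min_nonzero_eigval A / \<tau>) ^ l * ((x - xstar) \<bullet> (A *v (x - xstar)))"
proof -
  define R where "R = residual_mat A S"
  let ?p = "replicate_pmf l (diag_pmf R (- S))"
  let ?e = "x - xstar"
  have sumpos: "0 < (\<Sum>i\<in>-S. R $ i $ i)"
    using psd_matrix_trace_pos[OF residual_psd R0] residual_diag_zero
    unfolding trace_def R_def by (subst sum.mono_neutral_left[of UNIV "-S"]) auto
  have "measure_pmf.expectation (scrcd_step A b S l x) (\<lambda>x. (x - xstar) \<bullet> (A *v (x - xstar)))
      = measure_pmf.expectation ?p (\<lambda>js. (scrcd_update A b S (set js) x - xstar) \<bullet>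
          (A *v (scrcd_update A b S (set js) x - xstar)))"
    using R0 by (simp add: scrcd_step_def R_def)
  also have "\<dots> \<le> measure_pmf.expectation ?p
      (\<lambda>js. fold (coordinate_step R) js ?e \<bullet> (R *v fold (coordinate_step R) js ?e))"
  proof (intro expectation_mono_finite finite_set_replicate_pmf)
    fix js assume "js \<in> set_pmf ?p"
    then have J: "set js \<inter> S = {}"
      by (auto simp: set_replicate_pmf set_diag_pmf[OF residual_psd[folded R_def] sumpos])
    obtain y where "subvec y (set js) = y" "fold (coordinate_step R) js ?e = ?e - y"
      using fold_coordinate_step_supported by blast
    then show "(scrcd_update A b S (set js) x - xstar) \<bullet>
          (A *v (scrcd_update A b S (set js) x - xstar))
        \<le> fold (coordinate_step R) js ?e \<bullet> (R *v fold (coordinate_step R) js ?e)"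
      using scrcd_update_error(2)[OF psd Rres sol J feas]
        block_step_optimal[OF residual_psd[folded R_def], of y "set js" ?e] by (simp add: R_def)
  qed simp
  also have "\<dots> \<le> (1 - min_nonzero_eigval A / \<tau>) ^ l * (?e \<bullet> (R *v ?e))"
    unfolding R_def by (rule residual_sequential_steps(2)[OF R0])
  also have "?e \<bullet> (R *v ?e) = ?e \<bullet> (A *v ?e)"
    using scrcd_update_error(3)[OF psd Rres sol _ feas, of "{}"] by (simp add: R_def)
  finally show ?thesis .
qed

text \<open>
  If the residual matrix vanishes, the energy of the error is 0 from the start and the factor, which
  may then be negative, multiplies 0.
\<close>

theorem scrcd_expected_error:
  assumes init: "submat A S UNIV *v y = subvec b S"
  shows "measure_pmf.expectation (scrcd A b S l y k) (\<lambda>x. (energy_norm A (x - xstar))\<^sup>2)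
       \<le> (1 - min_nonzero_eigval A / \<tau>) ^ (k * l) * (energy_norm A (y - xstar))\<^sup>2"
proof -
  let ?h = "\<lambda>x. (x - xstar) \<bullet> (A *v (x - xstar))"
  have "subvec (A *v y) S = subvec b S"
    using init by (simp add: submat_mult_vec) (simp add: subvec_def)
  then have feas0: "subvec (A *v (y - xstar)) S = 0"
    by (simp add: sol matrix_vector_mult_diff_distrib subvec_diff)
  have feas: "subvec (A *v (x - xstar)) S = 0" if "x \<in> set_pmf (scrcd A b S l y k)" for x k
    using that
  proof (induction k arbitrary: x)
    case 0
    then show ?case using feas0 by simp
  next
    case (Suc k)
    then show ?case using scrcd_step_feasible by auto
  qed
  have "measure_pmf.expectation (scrcd A b S l y k) ?h \<le> (1 - min_nonzero_eigval A / \<tau>) ^ (k * l) * ?h y"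
  proof (cases "residual_mat A S = 0")
    case True
    have "scrcd A b S l y k = return_pmf y"
      by (induction k) (simp_all add: scrcd_step_def True bind_return_pmf)
    moreover have "?h y = 0"
      using scrcd_update_error(3)[OF psd Rres sol _ feas0, of "{}"] True by simp
    ultimately show ?thesis by simp
  next
    case False
    note q = residual_sequential_steps(1)[OF False]
    show ?thesis
    proof (induction k)
      case (Suc k)
      have "measure_pmf.expectation (scrcd A b S l y (Suc k)) ?h
          = measure_pmf.expectation (scrcd A b S l y k)
              (\<lambda>x. measure_pmf.expectation (scrcd_step A b S l x) ?h)"
        unfolding scrcd.simps by (intro expectation_bind_finite finite_set_scrcd finite_set_scrcd_step)
      also have "\<dots> \<le> measure_pmf.expectation (scrcd A b S l y k) (\<lambda>x. (1 - min_nonzero_eigval A / \<tau>) ^ l * ?h x)"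
        using feas False by (intro expectation_mono_finite finite_set_scrcd scrcd_step_expectation)
      also have "\<dots> = (1 - min_nonzero_eigval A / \<tau>) ^ l * measure_pmf.expectation (scrcd A b S l y k) ?h" by simp
      also have "\<dots> \<le> (1 - min_nonzero_eigval A / \<tau>) ^ l * ((1 - min_nonzero_eigval A / \<tau>) ^ (k * l) * ?h y)"
        using q Suc.IH by (intro mult_left_mono) auto
      finally show ?case by (simp add: power_add mult_ac)
    qed simp
  qed
  then show ?thesis by (simp add: energy_norm_squared[OF psd])
qed

end

section \<open>Conditioning on the pivot set\<close>

lemma expectation_cond_pmf_finite:
  fixes F :: "'a \<Rightarrow> real"
  assumes fin: "finite (set_pmf p)" and ne: "set_pmf p \<inter> E \<noteq> {}"
  shows "measure_pmf.expectation (cond_pmf p E) F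
       = measure_pmf.expectation p (\<lambda>x. if x \<in> E then F x else 0) / measure_pmf.prob p E"
proof -
  have "measure_pmf.expectation (cond_pmf p E) F
      = (\<Sum>x\<in>set_pmf p. pmf (cond_pmf p E) x *\<^sub>R F x)"
    using fin ne by (intro integral_measure_pmf) (auto simp: set_cond_pmf)
  also have "\<dots> = (\<Sum>x\<in>set_pmf p. pmf p x * (if x \<in> E then F x else 0) / measure_pmf.prob p E)"
    by (intro sum.cong) (auto simp: pmf_cond[OF ne])
  also have "\<dots> = measure_pmf.expectation p (\<lambda>x. if x \<in> E then F x else 0) / measure_pmf.prob p E"
    by (subst integral_measure_pmf[OF fin]) (auto simp: set_pmf_iff sum_divide_distrib)
  finally show ?thesis .
qed

text \<open>
  The event depends only on the first component, so conditioning the joint law weights the pivot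
  sets in the same way on both sides, and the inequality for fixed pivots can be averaged.
\<close>

lemma conditional_expectation_mono_joint:
  fixes g :: "'a \<Rightarrow> 'b \<Rightarrow> real" and h :: "'a \<Rightarrow> real"
  assumes fin: "finite (set_pmf p)" "\<And>s. s \<in> set_pmf p \<Longrightarrow> finite (set_pmf (f s))"
    and ne: "\<exists>s\<in>set_pmf p. P s"
    and le: "\<And>s. s \<in> set_pmf p \<Longrightarrow> P s \<Longrightarrow> measure_pmf.expectation (f s) (g s) \<le> c * h s"
  defines "joint \<equiv> bind_pmf p (\<lambda>s. map_pmf (Pair s) (f s))" and "E \<equiv> {(s, x). P s}"
  shows "measure_pmf.expectation (cond_pmf joint E) (\<lambda>(s, x). g s x)
       \<le> c * measure_pmf.expectation (cond_pmf joint E) (\<lambda>(s, x). h s)"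
proof -
  have finj: "finite (set_pmf joint)" using fin by (simp add: joint_def)
  have nej: "set_pmf joint \<inter> E \<noteq> {}"
  proof -
    obtain s where s: "s \<in> set_pmf p" "P s" using ne by blast
    obtain x where "x \<in> set_pmf (f s)" using set_pmf_not_empty by fast
    then have "(s, x) \<in> set_pmf joint \<inter> E" using s by (auto simp: joint_def E_def)
    then show ?thesis by blast
  qed
  have joint_exp: "measure_pmf.expectation joint (\<lambda>x. if x \<in> E then F x else 0)
      = measure_pmf.expectation p (\<lambda>s. if P s then measure_pmf.expectation (f s) (\<lambda>x. F (s, x)) else 0)"
    for F :: "'a \<times> 'b \<Rightarrow> real"
    unfolding joint_def using fin
    by (subst expectation_bind_finite) (auto simp: E_def intro!: Bochner_Integration.integral_cong)
  have "measure_pmf.expectation joint (\<lambda>x. if x \<in> E then (\<lambda>(s, x). g s x) x else 0)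
      \<le> measure_pmf.expectation p (\<lambda>s. c * (if P s then h s else 0))"
    unfolding joint_exp using fin(1) le by (intro expectation_mono_finite) auto
  also have "\<dots> = c * measure_pmf.expectation joint (\<lambda>x. if x \<in> E then (\<lambda>(s, x). h s) x else 0)"
    unfolding joint_exp by (simp cong: if_cong)
  finally show ?thesis
    unfolding expectation_cond_pmf_finite[OF finj nej]
    by (simp add: divide_right_mono)
qed

theorem theorem1p3:
  fixes A :: "real^'n^'n" and b xstar :: "real^'n" and x0 :: "'n set \<Rightarrow> real^'n"
    and d l r :: nat and \<delta> \<rho> :: real
  assumes sym: "transpose A = A"
    and psd: "\<And>z. 0 \<le> z \<bullet> (A *v z)"
    and sol: "A *v xstar = b"
    and block: "l \<ge> 1"
    and delta: "\<delta> > 0"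
    and rho: "0 < \<rho>" "\<rho> < 1"
    and eta_pos: "eta A r > 0"
    and rank: "real d \<ge> real r / \<delta> + real r * ln (1 / (\<delta> * eta A r))"
    and init: "\<And>S. S \<in> set_pmf (rpcholesky A d) \<Longrightarrow> submat A S UNIV *v x0 S = subvec b S"
  shows "measure_pmf.prob (rpcholesky A d)
           {S. trace (residual_mat A S) \<le> inverse \<rho> * (1 + \<delta>) * tail_sum A r} \<ge> 1 - \<rho>
    \<and> (\<forall>k. let E = {(S, x). trace (residual_mat A S) \<le> inverse \<rho> * (1 + \<delta>) * tail_sum A r}
           in measure_pmf.expectation (cond_pmf (rpc_scrcd A b d l x0 k) E)
                (\<lambda>(S, x). (energy_norm A (x - xstar))\<^sup>2)
              \<le> (1 - min_nonzero_eigval A / (inverse \<rho> * (1 + \<delta>) * tail_sum A r)) ^ (k * l)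
                * measure_pmf.expectation (cond_pmf (rpc_scrcd A b d l x0 k) E)
                    (\<lambda>(S, x). (energy_norm A (x0 S - xstar))\<^sup>2))
    \<and> (\<forall>k. \<forall>S \<in> set_pmf (rpcholesky A d).
           trace (residual_mat A S) \<le> inverse \<rho> * (1 + \<delta>) * tail_sum A r \<longrightarrow>
           measure_pmf.expectation (scrcd A b S l (x0 S) k) (\<lambda>x. (energy_norm A (x - xstar))\<^sup>2)
           \<le> (1 - min_nonzero_eigval A / (inverse \<rho> * (1 + \<delta>) * tail_sum A r)) ^ (k * l)
             * (energy_norm A (x0 S - xstar))\<^sup>2)"
proof -
  have psdA: "psd_matrix A" using sym psd by (simp add: psd_matrix_def)
  let ?c = "inverse \<rho> * (1 + \<delta>) * tail_sum A r"
  let ?good = "\<lambda>S. trace (residual_mat A S) \<le> ?c"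
  let ?q = "1 - min_nonzero_eigval A / ?c"
  note trace_bound = rpcholesky_expected_trace[OF psdA delta eta_pos rank]
  have A0: "A \<noteq> 0" using trace_bound(2) by (auto simp: trace_def)
  have prob: "1 - \<rho> \<le> measure_pmf.prob (rpcholesky A d) {S. ?good S}"
    using rpcholesky_trace_markov[OF psdA rho(1) _ trace_bound(3)] trace_bound(1) delta
    by (simp add: mult.assoc)
  have error: "measure_pmf.expectation (scrcd A b S l (x0 S) k) (\<lambda>x. (energy_norm A (x - xstar))\<^sup>2)
      \<le> ?q ^ (k * l) * (energy_norm A (x0 S - xstar))\<^sup>2"
    if S: "S \<in> set_pmf (rpcholesky A d)" and good: "?good S" for S k
  proof -
    obtain M where "(M, S) \<in> set_pmf (rpcholesky_state A d)"
      using S by (auto simp: rpcholesky_def)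
    then have "schur_residual A S M" by (rule rpcholesky_state_schur_residual[OF psdA])
    then have "schur_residual A S (residual_mat A S)"
      using schur_residual_unique[OF psdA] by metis
    then show ?thesis by (rule scrcd_expected_error[OF psdA A0 _ sol good init[OF S]])
  qed
  have "\<exists>S\<in>set_pmf (rpcholesky A d). ?good S"
  proof (rule ccontr)
    assume "\<not> ?thesis"
    then have "measure_pmf.prob (rpcholesky A d) {S. ?good S} = 0"
      by (subst measure_pmf_zero_iff) auto
    then show False using prob rho(2) by simp
  qed
  then have "measure_pmf.expectation (cond_pmf (rpc_scrcd A b d l x0 k) {(S, x). ?good S})
        (\<lambda>(S, x). (energy_norm A (x - xstar))\<^sup>2)
      \<le> ?q ^ (k * l) * measure_pmf.expectation (cond_pmf (rpc_scrcd A b d l x0 k) {(S, x). ?good S})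
        (\<lambda>(S, x). (energy_norm A (x0 S - xstar))\<^sup>2)" for k
    unfolding rpc_scrcd_def
    by (intro conditional_expectation_mono_joint error finite_set_scrcd) auto
  then show ?thesis using prob error by (simp only: Let_def) blast
qed

end
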